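(* Let $K$ be a number field with ring of integers $R$, let $\mathfrak{p}$ be a nonzero prime ideal of $R$, and let $q = p^{\ell}$ be the prime power such that $R/\mathfrak{p} \cong \mathbb{F}_q$. Let $n \in \mathbb{Z}^+$, let $A_1,\ldots,A_n$ be nonempty subsets of $R$ such that for each $i$ the elements of $A_i$ are pairwise incongruent modulo $\mathfrak{p}$, and put $A = \prod_{i=1}^n A_i$. Let $r,v_1,\ldots,v_r \in \mathbb{Z}^+$ and let $P_1,\ldots,P_r \in R[t_1,\ldots,t_n]$. Let \[ Z_A = \{ x \in A \mid P_j(x) \equiv 0 \pmod{\mathfrak{p}^{v_j}} \text{ for all } 1 \leq j \leq r\}, \qquad \mathbf{z}_A = \# Z_A. \] a) Either $\mathbf{z}_A = 0$ or \[ \mathbf{z}_A \geq \mathfrak{m}\Big( \# A_1,\ldots, \# A_n;\ \# A_1 + \ldots + \# A_n - \sum_{j=1}^r (q^{v_j} -1) \deg(P_j) \Big). \] b) The following two statements hold as special cases (consequences) of a). (i) (Warning's Second Theorem) Let $q$ be a prime power, let $n,r,d_1,\ldots,d_r \in \mathbb{Z}^+$ with $d := d_1+\ldots+d_r < n$, and for $1 \leq i \leq r$ let $P_i \in \mathbb{F}_q[t_1,\ldots,t_n]$ be a polynomial of degree $d_i$. Let $\mathbf{z} = \#\{x \in \mathbb{F}_q^n \mid P_1(x) = \ldots = P_r(x) = 0\}$. Then $\mathbf{z} = 0$ or $\mathbf{z} \geq q^{n-d}$. (ii) (Brink's Theorem in a number field) With $K,R,\mathfrak{p},q,A_1,\ldots,A_n,A,r,v_1,\ldots,v_r,P_1,\ldots,P_r,\mathbf{z}_A$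 as in the first paragraph: if $\sum_{j=1}^r (q^{v_j}-1)\deg(P_j) < \sum_{i=1}^n (\# A_i - 1)$, then $\mathbf{z}_A \neq 1$. In particular, if $A = \{0,1\}^n$ and $\sum_{j=1}^r (q^{v_j}-1)\deg(P_j) < n$, then $\mathbf{z}_A \neq 1$. c) (Boolean case) If $A = \{0,1\}^n$ (that is, $A_i = \{0,1\}$ for all $i$), then $\mathbf{z}_{\{0,1\}^n} = 0$ or \[ \mathbf{z}_{\{0,1\}^n} \geq 2^{\,n-\sum_{j=1}^r (q^{v_j} -1) \deg(P_j)}. \]
   Context: Definition of $\mathfrak{m}$. Let $a_1,\ldots,a_n \geq 1$ be integers. For an integer $N$ with $n \leq N \leq a_1+\ldots+a_n$, a distribution of $N$ balls is an $n$-tuple of integers $y = (y_1,\ldots,y_n)$ with $1 \leq y_i \leq a_i$ for all $i$ and $y_1+\ldots+y_n = N$; put $P(y) = y_1 \cdots y_n$. Then $\mathfrak{m}(a_1,\ldots,a_n;N)$ is the minimum of $P(y)$ over all such distributions. For integers $N < n$ put $\mathfrak{m}(a_1,\ldots,a_n;N) = 1$, and for integers $N > a_1+\ldots+a_n$ put $\mathfrak{m}(a_1,\ldots,a_n;N) = a_1\cdots a_n$. (The value does not depend on the order of $a_1,\ldots,a_n$.) $\deg$ denotes total degree; the zero polynomial is given degree $0$. The exponent of $2$ in c) may be negative. *)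

theory Defs
  imports
    "HOL-Algebra.Algebra"
    "HOL-Algebra.Algebraic_Closure_Type"
    "HOL-Library.FuncSet"
    "HOL-Library.Poly_Mapping"
begin

text \<open>
  A polynomial in the variables \<open>t\<^sub>1, \<dots>, t\<^sub>n\<close> is a finitely supported map from monomials to
  coefficients, and a monomial is a finitely supported map from variable indices to exponents.
\<close>

type_synonym 'a mpolynomial = "(nat \<Rightarrow>\<^sub>0 nat) \<Rightarrow>\<^sub>0 'a"

definition mpoly_carrier :: "'a::zero set \<Rightarrow> nat \<Rightarrow> 'a mpolynomial set" where
  "mpoly_carrier S n =
     {P. (\<forall>m. Poly_Mapping.lookup P m \<in> S) \<and>
         (\<forall>m\<in>Poly_Mapping.keys P. Poly_Mapping.keys m \<subseteq> {1..n})}"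

definition eval_mpoly :: "'a::comm_semiring_1 mpolynomial \<Rightarrow> (nat \<Rightarrow> 'a) \<Rightarrow> 'a" where
  "eval_mpoly P x =
     (\<Sum>m\<in>Poly_Mapping.keys P. Poly_Mapping.lookup P m *
        (\<Prod>i\<in>Poly_Mapping.keys m. x i ^ Poly_Mapping.lookup m i))"

definition monom_degree :: "(nat \<Rightarrow>\<^sub>0 nat) \<Rightarrow> nat" where
  "monom_degree m = (\<Sum>i\<in>Poly_Mapping.keys m. Poly_Mapping.lookup m i)"

text \<open>Inserting \<open>0\<close> gives the zero polynomial degree \<open>0\<close> and changes nothing else.\<close>

definition total_degree :: "'a::zero mpolynomial \<Rightarrow> nat" where
  "total_degree P = Max (insert 0 (monom_degree ` Poly_Mapping.keys P))"

definition min_distribution :: "nat \<Rightarrow> (nat \<Rightarrow> nat) \<Rightarrow> int \<Rightarrow> nat" where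
  "min_distribution n a N =
     (if N < int n then 1
      else if N > (\<Sum>i=1..n. int (a i)) then (\<Prod>i=1..n. a i)
      else Min {\<Prod>i=1..n. y i | y. (\<forall>i\<in>{1..n}. 1 \<le> y i \<and> y i \<le> a i) \<and>
                                   (\<Sum>i=1..n. int (y i)) = N})"

text \<open>
  Number fields are subfields of an arbitrary ambient field of characteristic zero; the ambient
  field may itself be the number field (\<open>K = UNIV\<close>), or for instance the complex numbers.
\<close>

definition number_field :: "'a::field_char_0 set \<Rightarrow> bool" where
  "number_field K \<longleftrightarrow>
     subfield K (ring_of_type_algebra :: 'a ring) \<and>
     ring.finite_dimension (ring_of_type_algebra :: 'a ring) \<rat> K"

definition ring_of_integers :: "'a::field_char_0 set \<Rightarrow> 'a ring" where
  "ring_of_integers K = ring_of_type_algebra\<lparr>carrier := {x \<in> K. algebraic_int x}\<rparr>"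

definition ideal_cong :: "'a::ab_group_add set \<Rightarrow> 'a \<Rightarrow> 'a \<Rightarrow> bool" where
  "ideal_cong I x y \<longleftrightarrow> x - y \<in> I"

text \<open>
  \<open>R/\<pp> \<cong> \<bbbF>\<^sub>q\<close> is rendered as: \<open>R/\<pp>\<close> is a field with \<open>q\<close> elements.
  Finiteness of the \<open>A i\<close> follows, as they embed into \<open>R/\<pp>\<close>.
\<close>

definition brink_setting ::
  "'a::field_char_0 set \<Rightarrow> 'a set \<Rightarrow> nat \<Rightarrow> nat \<Rightarrow> (nat \<Rightarrow> 'a set) \<Rightarrow> nat \<Rightarrow>
   (nat \<Rightarrow> nat) \<Rightarrow> (nat \<Rightarrow> 'a mpolynomial) \<Rightarrow> bool" where
  "brink_setting K \<pp> q n A r v P \<longleftrightarrow>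
     number_field K \<and>
     primeideal \<pp> (ring_of_integers K) \<and> \<pp> \<noteq> {0} \<and>
     (\<exists>p l::nat. Factorial_Ring.prime p \<and> l \<ge> 1 \<and> q = p ^ l) \<and>
     field (ring_of_integers K Quot \<pp>) \<and>
     card (carrier (ring_of_integers K Quot \<pp>)) = q \<and>
     n \<ge> 1 \<and>
     (\<forall>i\<in>{1..n}. A i \<noteq> {} \<and> A i \<subseteq> carrier (ring_of_integers K) \<and>
        (\<forall>x\<in>A i. \<forall>y\<in>A i. x \<noteq> y \<longrightarrow> \<not> ideal_cong \<pp> x y)) \<and>
     r \<ge> 1 \<and>
     (\<forall>j\<in>{1..r}. v j \<ge> 1 \<and> P j \<in> mpoly_carrier (carrier (ring_of_integers K)) n)"

text \<open>
  Powers of \<open>\<pp>\<close> are taken in the monoid of ideals of the ring of integers. Points of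
  \<open>A\<^sub>1 \<times> \<dots> \<times> A\<^sub>n\<close> are extensional functions, so that distinct functions are distinct points.
\<close>

definition restricted_zeros ::
  "'a::field_char_0 set \<Rightarrow> 'a set \<Rightarrow> nat \<Rightarrow> (nat \<Rightarrow> 'a set) \<Rightarrow> nat \<Rightarrow>
   (nat \<Rightarrow> nat) \<Rightarrow> (nat \<Rightarrow> 'a mpolynomial) \<Rightarrow> (nat \<Rightarrow> 'a) set" where
  "restricted_zeros K \<pp> n A r v P =
     {x \<in> PiE {1..n} A. \<forall>j\<in>{1..r}.
        ideal_cong (\<pp> [^]\<^bsub>ideals_set (ring_of_integers K)\<^esub> v j) (eval_mpoly (P j) x) 0}"

definition weighted_degree ::
  "nat \<Rightarrow> nat \<Rightarrow> (nat \<Rightarrow> nat) \<Rightarrow> (nat \<Rightarrow> 'a::zero mpolynomial) \<Rightarrow> int" where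
  "weighted_degree q r v P = (\<Sum>j=1..r. (int q ^ v j - 1) * int (total_degree (P j)))"

end

theory Submission
  imports Defs
begin

text \<open>
  Every lower bound comes from one statement, \<open>alon_furedi_submodule\<close>. Let \<open>F\<close> be a polynomial
  function of degree at most \<open>D\<close> on a finite grid \<open>A\<^sub>1 \<times> \<dots> \<times> A\<^sub>n\<close>, with values in a ring \<open>R\<close>, and let
  \<open>M\<close> be an \<open>R\<close>-submodule such that differences of distinct elements of each \<open>A\<^sub>i\<close> can be cancelled
  modulo \<open>M\<close>. If the set \<open>S\<close> of grid points with \<open>F x \<notin> M\<close> is nonempty, then there is a
  distribution \<open>y\<close> with \<open>1 \<le> y\<^sub>i \<le> #A\<^sub>i\<close>, with \<open>y\<^sub>1 + \<dots> + y\<^sub>n \<ge> #A\<^sub>1 + \<dots> + #A\<^sub>n - D\<close> and with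
  \<open>y\<^sub>1 \<cdots> y\<^sub>n \<le> #S\<close>. It has two ingredients.

  The first is combinatorial (\<open>exists_isolated_point\<close>): some point \<open>x\<^sub>0\<close> of \<open>S\<close> can be separated from
  the rest of \<open>S\<close> by a product \<open>g\<close> of linear factors \<open>x\<^sub>i - b\<close> with \<open>b \<in> B\<^sub>i\<close>, where the product of
  the numbers \<open>#B\<^sub>i + 1\<close> is at most \<open>#S\<close>: fix a coordinate, keep the smallest nonempty fibre over it,
  kill the other fibres, and recurse.

  The second is a duality (\<open>sum_grid_weight_polyfun_eq_0\<close>): with the weights of Lagrange
  interpolation, cleared of denominators, the weighted sum over the grid of a polynomial function of
  degree less than \<open>(#A\<^sub>1 - 1) + \<dots> + (#A\<^sub>n - 1)\<close> vanishes. If \<open>F g\<close> had such a degree, then all terms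
  of the weighted sum of \<open>F g\<close> except the one at \<open>x\<^sub>0\<close> would lie in \<open>M\<close>, hence so would \<open>F x\<^sub>0\<close>, after
  cancelling differences. So \<open>y\<^sub>i = #B\<^sub>i + 1\<close> is as required.

  For Warning's second theorem, take \<open>M = {0}\<close> and let \<open>F x\<close> be the product over all \<open>j\<close> and all
  \<open>b \<noteq> 0\<close> of \<open>P\<^sub>j x - b\<close>. In a number field, the nonzero residue classes modulo \<open>\<pp>\<^sup>v\<close> take the place of
  the nonzero elements \<open>b\<close>: there are a set \<open>B\<close> of at most \<open>q\<^sup>v - 1\<close> elements of \<open>R\<close> and a number \<open>E\<close>
  such that the product \<open>h\<close> of all \<open>y - b\<close>, \<open>b \<in> B\<close>, lies in \<open>\<pp>\<^sup>E\<close> but not in \<open>\<pp>\<^bsup>E+1\<^esup>\<close> if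
  \<open>y \<in> \<pp>\<^sup>v\<close>, and lies in \<open>\<pp>\<^bsup>E+1\<^esup>\<close> otherwise (\<open>exists_detecting_product\<close>). With \<open>h\<^sub>j\<close> and \<open>E\<^sub>j\<close> belonging
  to \<open>v\<^sub>j\<close>, \<open>F\<close> is the product of the functions \<open>h\<^sub>j (P\<^sub>j x)\<close> and \<open>M\<close> is the power of \<open>\<pp>\<close> with
  exponent \<open>1 + E\<^sub>1 + \<dots> + E\<^sub>r\<close>.

  The only arithmetic needed is that \<open>\<pp>\<close> is principal locally at \<open>\<pp>\<close>; then powers of \<open>\<pp>\<close> define
  valuations. This is \<open>exists_local_uniformizer\<close>; it uses that \<open>R\<close> is integrally closed and that
  \<open>R/lR\<close> is finite for a prime number \<open>l \<in> \<pp>\<close>, which holds because elements of \<open>R\<close> that are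
  independent modulo \<open>l\<close> are independent over the rationals.
\<close>

section \<open>Isolating a point of a finite set\<close>

text \<open>
  The product of the linear factors \<open>x i - b\<close>, where \<open>i \<in> I\<close> and \<open>b \<in> B i\<close>, vanishes on \<open>S\<close> except
  at \<open>x0\<close>.
\<close>
lemma exists_isolated_point:
  fixes S :: "('i \<Rightarrow> 'b) set"
  assumes "finite I" "finite S" "S \<noteq> {}"
    and "\<And>x y. x \<in> S \<Longrightarrow> y \<in> S \<Longrightarrow> (\<forall>i\<in>I. x i = y i) \<Longrightarrow> x = y"
  shows "\<exists>x0\<in>S. \<exists>B. (\<forall>i\<in>I. B i \<subseteq> (\<lambda>x. x i) ` S - {x0 i}) \<and>
           (\<Prod>i\<in>I. card (B i) + 1) \<le> card S \<and>
           (\<forall>x\<in>S. x \<noteq> x0 \<longrightarrow> (\<exists>i\<in>I. x i \<in> B i))"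
  using assms
proof (induction I arbitrary: S rule: finite_induct)
  case empty
  then obtain x0 where x0: "x0 \<in> S" by blast
  have "S = {x0}" using empty.prems(3) x0 by blast
  then show ?case by simp
next
  case (insert j I)
  define V where "V = (\<lambda>x. x j) ` S"
  define fib where "fib c = {x \<in> S. x j = c}" for c
  have V: "finite V" "V \<noteq> {}" using insert.prems by (auto simp: V_def)
  \<comment> \<open>The smallest nonempty fibre of the coordinate \<open>j\<close> has at most \<open>card S / card V\<close> points.\<close>
  obtain c where "is_arg_min (\<lambda>c. card (fib c)) (\<lambda>c. c \<in> V) c"
    using ex_is_arg_min_if_finite[OF V] by blast
  then have c: "c \<in> V" and cmin: "\<And>c'. c' \<in> V \<Longrightarrow> card (fib c) \<le> card (fib c')"
    by (auto simp: is_arg_min_linorder)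
  have "card S = card (\<Union>c'\<in>V. fib c')" by (rule arg_cong[of _ _ card]) (auto simp: V_def fib_def)
  also have "\<dots> = (\<Sum>c'\<in>V. card (fib c'))"
    using V insert.prems by (subst card_UN_disjoint) (auto simp: fib_def)
  also have "\<dots> \<ge> card V * card (fib c)" using sum_bounded_below[of V "card (fib c)" "\<lambda>c. card (fib c)"] cmin by auto
  finally have card_le: "card V * card (fib c) \<le> card S" .
  have fS: "finite (fib c)" "fib c \<noteq> {}" "fib c \<subseteq> S"
    using insert.prems c by (auto simp: fib_def V_def)
  have "\<And>x y. x \<in> fib c \<Longrightarrow> y \<in> fib c \<Longrightarrow> (\<forall>i\<in>I. x i = y i) \<Longrightarrow> x = y"
    using insert.prems(3) by (auto simp: fib_def)
  from insert.IH[OF fS(1,2) this] obtain x0 B where x0: "x0 \<in> fib c"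
    and B: "\<forall>i\<in>I. B i \<subseteq> (\<lambda>x. x i) ` fib c - {x0 i}"
    and Bc: "(\<Prod>i\<in>I. card (B i) + 1) \<le> card (fib c)"
    and Bx: "\<forall>x\<in>fib c. x \<noteq> x0 \<longrightarrow> (\<exists>i\<in>I. x i \<in> B i)" by blast
  define B' where "B' = B(j := V - {c})"
  have same: "B' i = B i" if "i \<in> I" for i using that insert.hyps by (auto simp: B'_def)
  have "(\<Prod>i\<in>insert j I. card (B' i) + 1) = (card (V - {c}) + 1) * (\<Prod>i\<in>I. card (B i) + 1)"
    using insert.hyps by (simp add: same B'_def[of, THEN fun_cong, of j] cong: prod.cong)
  also have "card (V - {c}) + 1 = card V" using c V by (metis Suc_eq_plus1 card.remove)
  also have "card V * (\<Prod>i\<in>I. card (B i) + 1) \<le> card V * card (fib c)" using Bc by simp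
  finally have "(\<Prod>i\<in>insert j I. card (B' i) + 1) \<le> card S" using card_le by linarith
  moreover have "B' i \<subseteq> (\<lambda>x. x i) ` S - {x0 i}" if "i \<in> insert j I" for i
  proof (cases "i = j")
    case True then show ?thesis using x0 by (auto simp: B'_def V_def fib_def)
  next
    case False
    then have "i \<in> I" using that by blast
    then show ?thesis using B image_mono[OF fS(3), of "\<lambda>x. x i"] same[of i] by blast
  qed
  moreover have "\<exists>i\<in>insert j I. x i \<in> B' i" if "x \<in> S" "x \<noteq> x0" for x
  proof (cases "x j = c")
    case True then show ?thesis using Bx that same by (auto simp: fib_def)
  next
    case False then show ?thesis using that by (auto simp: B'_def V_def)
  qed
  ultimately show ?case using x0 fS(3) by blast
qed

section \<open>Weights that annihilate polynomial functions of low degree\<close>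

text \<open>
  The weight of the node \<open>a\<close> in Lagrange interpolation on \<open>A\<close> is the inverse of the product of all
  \<open>a - b\<close> with \<open>b \<noteq> a\<close>. Here it is multiplied by the product of all differences of distinct nodes,
  so that it is itself a product of such differences.
\<close>
definition interp_weight :: "'a::field set \<Rightarrow> 'a \<Rightarrow> 'a" where
  "interp_weight A a = (\<Prod>c\<in>A - {a}. \<Prod>b\<in>A - {c}. c - b)"

text \<open>
  The left-hand side is the divided difference of \<open>x ^ e\<close> at the nodes \<open>A\<close>.
\<close>
lemma divided_difference_power_eq_0:
  fixes A :: "'a::field set"
  assumes "finite A" "e + 1 < card A"
  shows "(\<Sum>a\<in>A. a ^ e / (\<Prod>b\<in>A - {a}. a - b)) = 0"
proof -
  define D where "D A e = (\<Sum>a\<in>A. a ^ e / (\<Prod>b\<in>A - {a}. a - b))" for A :: "'a set" and e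
  \<comment> \<open>Multiplying a function by \<open>x - c\<close> has the effect of deleting the node \<open>c\<close>.\<close>
  have remove: "D A (Suc e) - c * D A e = D (A - {c}) e"
    if "finite A" "c \<in> A" for A c e
  proof -
    have "D A (Suc e) - c * D A e = (\<Sum>a\<in>A. (a - c) * (a ^ e / (\<Prod>b\<in>A - {a}. a - b)))"
      by (simp add: D_def sum_distrib_left sum_subtractf[symmetric] algebra_simps diff_divide_distrib)
    also have "\<dots> = (\<Sum>a\<in>A - {c}. (a - c) * (a ^ e / (\<Prod>b\<in>A - {a}. a - b)))"
      using that by (subst sum.remove[of A c]) auto
    also have "\<dots> = D (A - {c}) e"
      unfolding D_def
    proof (rule sum.cong)
      fix a assume a: "a \<in> A - {c}"
      have "(\<Prod>b\<in>A - {a}. a - b) = (a - c) * (\<Prod>b\<in>A - {a} - {c}. a - b)"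
        using a that by (subst prod.remove[of "A - {a}" c]) auto
      moreover have "A - {a} - {c} = A - {c} - {a}" by auto
      ultimately show "(a - c) * (a ^ e / (\<Prod>b\<in>A - {a}. a - b)) = a ^ e / (\<Prod>b\<in>A - {c} - {a}. a - b)"
        using a by simp
    qed simp
    finally show ?thesis .
  qed
  have const: "D A 0 = 0" if "finite A" "card A \<ge> 2" for A
    using that
  proof (induction "card A" arbitrary: A rule: less_induct)
    case less
    have "\<not> card A \<le> Suc 0" using less.prems(2) by simp
    then obtain c c' where cc: "c \<in> A" "c' \<in> A" "c \<noteq> c'"
      using card_le_Suc0_iff_eq[OF less.prems(1)] by blast
    have eq: "(c' - c) * D A 0 = D (A - {c}) 0 - D (A - {c'}) 0"
      using remove[OF less.prems(1) cc(1), of 0] remove[OF less.prems(1) cc(2), of 0]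
      by (simp add: algebra_simps)
    have "D (A - {c}) 0 = D (A - {c'}) 0"
    proof (cases "card A = 2")
      case True
      then obtain u w where "A = {u, w}" by (meson card_2_iff)
      then have "A - {c} = {c'}" "A - {c'} = {c}" using cc by auto
      then show ?thesis by (simp add: D_def)
    next
      case False
      then show ?thesis using less.hyps[of "A - {c}"] less.hyps[of "A - {c'}"] less.prems cc by simp
    qed
    then show ?case using eq cc by simp
  qed
  have "D A e = 0"
    using assms
  proof (induction e arbitrary: A)
    case 0
    then show ?case using const[of A] by simp
  next
    case (Suc e)
    then obtain c where c: "c \<in> A" by (metis card.empty all_not_in_conv not_less0)
    have "D (A - {c}) e = 0" "D A e = 0" using Suc c by auto
    then show ?case using remove[OF Suc.prems(1) c, of e] by simp
  qed
  then show ?thesis by (simp add: D_def)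
qed

lemma sum_interp_weight_power:
  fixes A :: "'a::field set"
  assumes "finite A" "e + 1 < card A"
  shows "(\<Sum>a\<in>A. interp_weight A a * a ^ e) = 0"
proof -
  define W where "W = (\<Prod>c\<in>A. \<Prod>b\<in>A - {c}. c - b)"
  have "interp_weight A a * a ^ e = W * (a ^ e / (\<Prod>b\<in>A - {a}. a - b))" if "a \<in> A" for a
  proof -
    have "W = (\<Prod>b\<in>A - {a}. a - b) * interp_weight A a"
      unfolding W_def interp_weight_def using assms that by (subst prod.remove[of A a]) auto
    moreover have "(\<Prod>b\<in>A - {a}. a - b) \<noteq> 0" using assms by auto
    ultimately show ?thesis by (simp add: field_simps)
  qed
  then have "(\<Sum>a\<in>A. interp_weight A a * a ^ e) = W * (\<Sum>a\<in>A. a ^ e / (\<Prod>b\<in>A - {a}. a - b))"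
    by (simp add: sum_distrib_left)
  then show ?thesis using divided_difference_power_eq_0[OF assms] by simp
qed

text \<open>
  \<open>polyfun I d f\<close> says that \<open>f\<close> is a polynomial function of the coordinates in \<open>I\<close> that has a
  representation of total degree at most \<open>d\<close>.
\<close>
inductive polyfun :: "nat set \<Rightarrow> nat \<Rightarrow> ((nat \<Rightarrow> 'a::comm_ring_1) \<Rightarrow> 'a) \<Rightarrow> bool" for I where
  polyfun_const: "polyfun I d (\<lambda>_. c)"
| polyfun_var: "i \<in> I \<Longrightarrow> polyfun I d f \<Longrightarrow> polyfun I (Suc d) (\<lambda>x. x i * f x)"
| polyfun_add: "polyfun I d f \<Longrightarrow> polyfun I d g \<Longrightarrow> polyfun I d (\<lambda>x. f x + g x)"

lemma polyfun_mono:
  assumes "polyfun I d f" "d \<le> e" shows "polyfun I e f"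
  using assms
proof (induction arbitrary: e rule: polyfun.induct)
  case (polyfun_var i d f)
  then obtain e' where "e = Suc e'" "d \<le> e'" by (cases e) auto
  then show ?case using polyfun_var by (simp add: polyfun.polyfun_var)
qed (auto intro: polyfun.intros)

lemma polyfun_mult:
  assumes "polyfun I d f" "polyfun I e g"
  shows "polyfun I (d + e) (\<lambda>x. f x * g x)"
  using assms
proof (induction arbitrary: e rule: polyfun.induct)
  case (polyfun_const d c)
  have "polyfun I e (\<lambda>x. c * g x)"
    using polyfun_const
  proof (induction rule: polyfun.induct)
    case (polyfun_const d b) show ?case by (rule polyfun.polyfun_const)
  next
    case (polyfun_var i d f)
    show ?case using polyfun.polyfun_var[OF polyfun_var(1,3)] by (simp add: algebra_simps)
  next
    case (polyfun_add d f g)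
    then show ?case using polyfun.polyfun_add[OF polyfun_add(3,4)] by (simp add: algebra_simps)
  qed
  then show ?case by (rule polyfun_mono) simp
next
  case (polyfun_var i d f)
  show ?case using polyfun.polyfun_var[OF polyfun_var(1) polyfun_var(3)[OF polyfun_var(4)]]
    by (simp add: algebra_simps)
next
  case (polyfun_add d f h)
  show ?case using polyfun.polyfun_add[OF polyfun_add(3,4)[OF polyfun_add(5)]]
    by (simp add: algebra_simps)
qed

lemma polyfun_prod:
  assumes "\<And>j. j \<in> J \<Longrightarrow> polyfun I (d j) (f j)"
  shows "polyfun I (\<Sum>j\<in>J. d j) (\<lambda>x. \<Prod>j\<in>J. f j x)"
  using assms
  by (induction J rule: infinite_finite_induct) (auto intro!: polyfun_const polyfun_mult)

lemma polyfun_sum: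
  assumes "\<And>j. j \<in> J \<Longrightarrow> polyfun I d (f j)"
  shows "polyfun I d (\<lambda>x. \<Sum>j\<in>J. f j x)"
  using assms
  by (induction J rule: infinite_finite_induct) (auto intro!: polyfun_const polyfun_add)

lemma polyfun_diff_const:
  assumes "polyfun I d f" shows "polyfun I d (\<lambda>x. f x - c)"
  using polyfun_add[OF assms polyfun_const[of I d "- c"]] by simp

lemma polyfun_coordinate:
  assumes "i \<in> I" shows "polyfun I 1 (\<lambda>x. x i)"
  using polyfun_var[OF assms polyfun_const[of I 0 1]] by simp

lemma polyfun_power:
  assumes "polyfun I d f" shows "polyfun I (k * d) (\<lambda>x. f x ^ k)"
  using polyfun_prod[of "{..<k}" I "\<lambda>_. d" "\<lambda>_. f"] assms by simp

lemma polyfun_eval_mpoly: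
  assumes "P \<in> mpoly_carrier R n"
  shows "polyfun {1..n} (total_degree P) (eval_mpoly P)"
proof -
  have "polyfun {1..n} (total_degree P) (\<lambda>x. Poly_Mapping.lookup P m *
          (\<Prod>i\<in>Poly_Mapping.keys m. x i ^ Poly_Mapping.lookup m i))"
    if m: "m \<in> Poly_Mapping.keys P" for m
  proof -
    have sub: "Poly_Mapping.keys m \<subseteq> {1..n}" using assms m by (auto simp: mpoly_carrier_def)
    have "polyfun {1..n} (\<Sum>i\<in>Poly_Mapping.keys m. Poly_Mapping.lookup m i * 1)
            (\<lambda>x. \<Prod>i\<in>Poly_Mapping.keys m. x i ^ Poly_Mapping.lookup m i)"
      using sub by (intro polyfun_prod polyfun_power polyfun_coordinate) auto
    moreover have "(\<Sum>i\<in>Poly_Mapping.keys m. Poly_Mapping.lookup m i) \<le> total_degree P"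
      using m by (auto simp: total_degree_def monom_degree_def intro!: Max_ge)
    ultimately have "polyfun {1..n} (total_degree P)
            (\<lambda>x. \<Prod>i\<in>Poly_Mapping.keys m. x i ^ Poly_Mapping.lookup m i)"
      using polyfun_mono by fastforce
    from polyfun_mult[OF polyfun_const[of _ 0] this] show ?thesis by simp
  qed
  then have "polyfun {1..n} (total_degree P) (\<lambda>x. \<Sum>m\<in>Poly_Mapping.keys P. Poly_Mapping.lookup P m *
          (\<Prod>i\<in>Poly_Mapping.keys m. x i ^ Poly_Mapping.lookup m i))"
    by (rule polyfun_sum)
  then show ?thesis by (simp add: eval_mpoly_def[abs_def])
qed

text \<open>
  For a monomial, the sum over the grid factors into sums over the \<open>A i\<close>, and one of them vanishes
  because some exponent is less than \<open>card (A i) - 1\<close>.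
\<close>
lemma sum_grid_weight_polyfun_eq_0:
  fixes A :: "nat \<Rightarrow> 'a::field set"
  assumes "polyfun I d f" "finite I" "\<And>i. i \<in> I \<Longrightarrow> finite (A i)"
    and "d < (\<Sum>i\<in>I. card (A i) - 1)"
  shows "(\<Sum>x\<in>PiE I A. (\<Prod>i\<in>I. interp_weight (A i) (x i)) * f x) = 0"
proof -
  \<comment> \<open>An additional monomial factor makes the induction over \<open>f\<close> go through.\<close>
  have "(\<Sum>x\<in>PiE I A. (\<Prod>i\<in>I. interp_weight (A i) (x i)) * ((\<Prod>i\<in>I. x i ^ e i) * f x)) = 0"
    if "(\<Sum>i\<in>I. e i) + d < (\<Sum>i\<in>I. card (A i) - 1)" for e
    using assms(1) that
  proof (induction arbitrary: e rule: polyfun.induct)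
    case (polyfun_const d c)
    have "\<exists>i\<in>I. e i < card (A i) - 1"
    proof (rule ccontr)
      assume "\<not> ?thesis"
      then have "(\<Sum>i\<in>I. card (A i) - 1) \<le> (\<Sum>i\<in>I. e i)" by (intro sum_mono) auto
      then show False using polyfun_const by simp
    qed
    then obtain i where i: "i \<in> I" "e i < card (A i) - 1" by blast
    have "(\<Sum>x\<in>PiE I A. (\<Prod>i\<in>I. interp_weight (A i) (x i)) * ((\<Prod>i\<in>I. x i ^ e i) * c))
        = (\<Sum>x\<in>PiE I A. \<Prod>i\<in>I. interp_weight (A i) (x i) * x i ^ e i) * c"
      by (simp add: prod.distrib sum_distrib_right mult.assoc)
    also have "(\<Sum>x\<in>PiE I A. \<Prod>i\<in>I. interp_weight (A i) (x i) * x i ^ e i)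
       = (\<Prod>i\<in>I. \<Sum>a\<in>A i. interp_weight (A i) a * a ^ e i)"
      using assms by (subst prod_sum_PiE) auto
    also have "\<dots> = 0"
      using i assms sum_interp_weight_power[of "A i" "e i"] by (auto intro!: prod_zero bexI[of _ i])
    finally show ?case by simp
  next
    case (polyfun_var i d f)
    define e' where "e' = e(i := Suc (e i))"
    have split: "(\<Prod>k\<in>I. x k ^ e k) = x i ^ e i * (\<Prod>k\<in>I - {i}. x k ^ e k)"
         "(\<Prod>k\<in>I. x k ^ e' k) = x i ^ e' i * (\<Prod>k\<in>I - {i}. x k ^ e' k)"
      for x :: "nat \<Rightarrow> 'a" using assms polyfun_var by (simp_all add: prod.remove)
    have "(\<Sum>k\<in>I. e' k) = Suc (\<Sum>k\<in>I. e k)"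
      using assms polyfun_var by (simp add: sum.remove[of I i] e'_def)
    moreover have "(\<Prod>k\<in>I. x k ^ e' k) = (\<Prod>k\<in>I. x k ^ e k) * x i" for x :: "nat \<Rightarrow> 'a"
      unfolding split by (simp add: e'_def mult_ac)
    ultimately show ?case using polyfun_var.IH[of e'] polyfun_var.prems by (simp add: mult_ac)
  next
    case (polyfun_add d f g)
    then show ?case by (simp add: distrib_left sum.distrib)
  qed
  from this[of "\<lambda>_. 0"] show ?thesis using assms by simp
qed

section \<open>Points of a grid where a polynomial function avoids a submodule\<close>

text \<open>
  A form of the Alon-Furedi theorem. The set \<open>U\<close> consists of elements that can be cancelled modulo
  the submodule \<open>M\<close>.
\<close>
lemma alon_furedi_submodule:
  fixes A :: "nat \<Rightarrow> 'a::field set"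
  assumes finI: "finite I" and finA: "\<And>i. i \<in> I \<Longrightarrow> finite (A i)"
    and F: "polyfun I D F" and FR: "\<And>x. x \<in> PiE I A \<Longrightarrow> F x \<in> R"
    and M0: "0 \<in> M" and Madd: "\<And>x y. x \<in> M \<Longrightarrow> y \<in> M \<Longrightarrow> x + y \<in> M"
    and Mmult: "\<And>r x. r \<in> R \<Longrightarrow> x \<in> M \<Longrightarrow> r * x \<in> M" and Rm1: "- 1 \<in> R"
    and UR: "U \<subseteq> R" and U1: "1 \<in> U" and Umult: "\<And>x y. x \<in> U \<Longrightarrow> y \<in> U \<Longrightarrow> x * y \<in> U"
    and Udiff: "\<And>i a b. i \<in> I \<Longrightarrow> a \<in> A i \<Longrightarrow> b \<in> A i \<Longrightarrow> a \<noteq> b \<Longrightarrow> a - b \<in> U"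
    and AR: "\<And>i. i \<in> I \<Longrightarrow> A i \<subseteq> R"
    and Rdiff: "\<And>x y. x \<in> R \<Longrightarrow> y \<in> R \<Longrightarrow> x - y \<in> R" 
    and Rmult: "\<And>x y. x \<in> R \<Longrightarrow> y \<in> R \<Longrightarrow> x * y \<in> R"
    and Ucancel: "\<And>u x. u \<in> U \<Longrightarrow> x \<in> R \<Longrightarrow> u * x \<in> M \<Longrightarrow> x \<in> M"
    and ne: "{x \<in> PiE I A. F x \<notin> M} \<noteq> {}"
  shows "\<exists>y. (\<forall>i\<in>I. 1 \<le> y i \<and> y i \<le> card (A i)) \<and>
             (\<Sum>i\<in>I. card (A i)) \<le> (\<Sum>i\<in>I. y i) + D \<and>
             (\<Prod>i\<in>I. y i) \<le> card {x \<in> PiE I A. F x \<notin> M}"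
proof -
  define S where "S = {x \<in> PiE I A. F x \<notin> M}"
  have finPi: "finite (PiE I A)" using finI finA by (rule finite_PiE)
  have "finite S" "S \<noteq> {}" using finPi ne by (auto simp: S_def)
  moreover have "x = y" if "x \<in> S" "y \<in> S" "\<forall>i\<in>I. x i = y i" for x y
    using that unfolding S_def by (blast intro: PiE_ext)
  ultimately obtain x0 B where x0: "x0 \<in> S"
    and B: "\<forall>i\<in>I. B i \<subseteq> (\<lambda>x. x i) ` S - {x0 i}"
    and cardB: "(\<Prod>i\<in>I. card (B i) + 1) \<le> card S"
    and Bx: "\<forall>x\<in>S. x \<noteq> x0 \<longrightarrow> (\<exists>i\<in>I. x i \<in> B i)"
    using exists_isolated_point[OF finI, of S] by blast
  have x0A: "x0 i \<in> A i" if "i \<in> I" for i using x0 that by (auto simp: S_def)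
  have BA: "B i \<subseteq> A i - {x0 i}" if "i \<in> I" for i using B that by (auto simp: S_def)
  have Uprod: "(\<Prod>k\<in>J. g k) \<in> U" if "\<And>k. k \<in> J \<Longrightarrow> g k \<in> U" for J :: "'b set" and g
    using that by (induction J rule: infinite_finite_induct) (auto intro: U1 Umult)
  have Rprod: "(\<Prod>k\<in>J. g k) \<in> R" if "\<And>k. k \<in> J \<Longrightarrow> g k \<in> R" for J :: "'b set" and g
    using that U1 UR by (induction J rule: infinite_finite_induct) (auto intro: Rmult)
  have Msum: "(\<Sum>k\<in>J. h k) \<in> M" if "\<And>k. k \<in> J \<Longrightarrow> h k \<in> M" for J :: "'b set" and h
    using that by (induction J rule: infinite_finite_induct) (auto intro: M0 Madd)
  \<comment> \<open>\<open>g\<close> vanishes on \<open>S\<close> except at \<open>x0\<close>, where its value is a product of cancellable differences.\<close>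
  define g where "g x = (\<Prod>i\<in>I. \<Prod>b\<in>B i. x i - b)" for x
  define w where "w x = (\<Prod>i\<in>I. interp_weight (A i) (x i))" for x
  have wU: "w x \<in> U" if "x \<in> PiE I A" for x
    unfolding w_def interp_weight_def by (intro Uprod Udiff) auto
  have gR: "g x \<in> R" if "x \<in> PiE I A" for x
    unfolding g_def using that BA AR by (intro Rprod Rdiff) (auto simp: PiE_iff, blast+)
  have gU: "g x0 \<in> U"
    unfolding g_def by (intro Uprod Udiff) (use BA x0A in auto)
  have "polyfun I (\<Sum>i\<in>I. \<Sum>b\<in>B i. 1) g"
    unfolding g_def[abs_def] by (intro polyfun_prod polyfun_diff_const polyfun_coordinate)
  then have Fg: "polyfun I (D + (\<Sum>i\<in>I. card (B i))) (\<lambda>x. F x * g x)"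
    using polyfun_mult[OF F] by simp
  have deg: "(\<Sum>i\<in>I. card (A i) - 1) \<le> D + (\<Sum>i\<in>I. card (B i))"
  proof (rule ccontr)
    assume "\<not> ?thesis"
    then have "(\<Sum>x\<in>PiE I A. w x * (F x * g x)) = 0"
      unfolding w_def by (intro sum_grid_weight_polyfun_eq_0[OF Fg finI finA]) auto
    moreover have "(\<Sum>x\<in>PiE I A. w x * (F x * g x)) =
        w x0 * (F x0 * g x0) + (\<Sum>x\<in>PiE I A - {x0}. w x * (F x * g x))"
      using x0 finPi by (intro sum.remove) (auto simp: S_def)
    moreover have "(\<Sum>x\<in>PiE I A - {x0}. w x * (F x * g x)) \<in> M"
    proof -
      have "w x * (F x * g x) \<in> M" if x: "x \<in> PiE I A - {x0}" for x
      proof (cases "x \<in> S")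
        case True
        then obtain i where "i \<in> I" "x i \<in> B i" using Bx x by blast
        moreover have "finite (B i)" using BA[OF \<open>i \<in> I\<close>] finA[OF \<open>i \<in> I\<close>] by (meson finite_Diff finite_subset)
        ultimately have "g x = 0" unfolding g_def using finI by (intro prod_zero bexI[of _ i]) auto
        then show ?thesis using M0 by simp
      next
        case False
        then have "F x \<in> M" using x by (auto simp: S_def)
        moreover have "w x * g x \<in> R" using wU gR UR x by (auto intro: Rmult)
        ultimately have "(w x * g x) * F x \<in> M" by (intro Mmult)
        then show ?thesis by (simp add: mult_ac)
      qed
      then show ?thesis by (rule Msum)
    qed
    ultimately have "(w x0 * g x0) * F x0 \<in> M"
      using Mmult[OF Rm1, of "(\<Sum>x\<in>PiE I A - {x0}. w x * (F x * g x))"]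
      by (simp add: eq_neg_iff_add_eq_0[symmetric] mult_ac)
    moreover have "w x0 * g x0 \<in> U" using wU gU x0 by (auto simp: S_def intro: Umult)
    ultimately have "F x0 \<in> M" using Ucancel FR x0 by (auto simp: S_def)
    then show False using x0 by (auto simp: S_def)
  qed
  have pos: "card (A i) > 0" if "i \<in> I" for i using x0A[OF that] finA[OF that] by (auto simp: card_gt_0_iff)
  have "(\<Sum>i\<in>I. card (A i)) = (\<Sum>i\<in>I. (card (A i) - 1) + 1)" by (intro sum.cong) (use pos in auto)
  also have "\<dots> = (\<Sum>i\<in>I. card (A i) - 1) + card I" by (simp only: sum.distrib) simp
  also have "\<dots> \<le> ((\<Sum>i\<in>I. card (B i)) + card I) + D" using deg by linarith
  also have "(\<Sum>i\<in>I. card (B i)) + card I = (\<Sum>i\<in>I. card (B i) + 1)"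
    by (simp only: sum.distrib) simp
  finally have "(\<Sum>i\<in>I. card (A i)) \<le> (\<Sum>i\<in>I. card (B i) + 1) + D" .
  moreover have "card (B i) + 1 \<le> card (A i)" if "i \<in> I" for i
  proof -
    have "card (B i) \<le> card (A i - {x0 i})" using BA[OF that] finA[OF that] by (intro card_mono) auto
    then show ?thesis using x0A[OF that] pos[OF that] by simp
  qed
  ultimately show ?thesis using cardB unfolding S_def
    by (intro exI[of _ "\<lambda>i. card (B i) + 1"]) auto
qed

section \<open>Prime ideals that are locally principal\<close>

text \<open>
  Two members of a sequence are congruent modulo \<open>M\<close> if finitely many elements represent all classes
  that occur.
\<close>
lemma pigeonhole_cover:
  fixes g :: "nat \<Rightarrow> 'a::ab_group_add"
  assumes "finite C" "\<And>k. \<exists>c\<in>C. g k - c \<in> M"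
    and "\<And>x y. x \<in> M \<Longrightarrow> y \<in> M \<Longrightarrow> x - y \<in> M"
  shows "\<exists>i j. i < j \<and> g j - g i \<in> M"
proof -
  obtain h where h: "\<And>k. h k \<in> C \<and> g k - h k \<in> M" using assms(2) by metis
  have "\<not> inj h"
    using h assms(1) finite_subset[of "range h" C] finite_imageD[of h UNIV] by auto
  then obtain i j where "i \<noteq> j" "h i = h j" by (auto simp: inj_def)
  then obtain i j where ij: "i < j" "h i = h j" by (metis linorder_neqE_nat)
  have "(g j - h j) - (g i - h i) \<in> M" using assms(3) h by blast
  then show ?thesis using ij by auto
qed

text \<open>
  A prime ideal \<open>P\<close> of a subring \<open>R\<close> of a field, both given as subsets of the field.
\<close>
locale subring_with_prime =
  fixes R P :: "'a::field set"
  assumes R0: "0 \<in> R" and R1: "1 \<in> R"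
    and Radd: "x \<in> R \<Longrightarrow> y \<in> R \<Longrightarrow> x + y \<in> R"
    and Rminus: "x \<in> R \<Longrightarrow> - x \<in> R"
    and Rmult: "x \<in> R \<Longrightarrow> y \<in> R \<Longrightarrow> x * y \<in> R"
    and PR: "P \<subseteq> R" and P0: "0 \<in> P" and P1: "1 \<notin> P"
    and Padd: "x \<in> P \<Longrightarrow> y \<in> P \<Longrightarrow> x + y \<in> P"
    and Pmult: "x \<in> R \<Longrightarrow> y \<in> P \<Longrightarrow> x * y \<in> P"
    and Pprime: "x \<in> R \<Longrightarrow> y \<in> R \<Longrightarrow> x * y \<in> P \<Longrightarrow> x \<in> P \<or> y \<in> P"
begin

lemma Rdiff: "x \<in> R \<Longrightarrow> y \<in> R \<Longrightarrow> x - y \<in> R"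
  using Radd[of x "- y"] Rminus by simp

lemma Rpower: "x \<in> R \<Longrightarrow> x ^ k \<in> R"
  by (induction k) (auto intro: R1 Rmult)

lemma Rprod: "(\<And>k. k \<in> J \<Longrightarrow> g k \<in> R) \<Longrightarrow> (\<Prod>k\<in>J. g k) \<in> R"
  by (induction J rule: infinite_finite_induct) (auto intro: R1 Rmult)

lemma Rsum: "(\<And>k. k \<in> J \<Longrightarrow> g k \<in> R) \<Longrightarrow> (\<Sum>k\<in>J. g k) \<in> R"
  by (induction J rule: infinite_finite_induct) (auto intro: R0 Radd)

lemma Rof_nat: "of_nat k \<in> R"
  by (induction k) (auto intro: R0 R1 Radd)

lemma Rof_int: "of_int k \<in> R"
  by (cases k) (auto intro: Rof_nat Rminus simp del: of_nat_Suc)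

lemma Pminus: "x \<in> P \<Longrightarrow> - x \<in> P"
  using Pmult[of "- 1" x] R1 Rminus by simp

lemma Pdiff: "x \<in> P \<Longrightarrow> y \<in> P \<Longrightarrow> x - y \<in> P"
  using Padd[of x "- y"] Pminus by simp

lemma mult_mem_P_iff: "x \<in> R \<Longrightarrow> y \<in> R \<Longrightarrow> x * y \<in> P \<longleftrightarrow> x \<in> P \<or> y \<in> P"
  using Pprime[of x y] Pmult[of x y] Pmult[of y x] by (auto simp: mult.commute)

lemma power_mem_P: "x \<in> R \<Longrightarrow> x ^ k \<in> P \<Longrightarrow> x \<in> P"
  using P1 by (induction k) (auto simp: mult_mem_P_iff Rpower)

lemma power_Suc_mem_P: "x \<in> P \<Longrightarrow> x ^ Suc k \<in> P"
  using Pmult[of "x ^ k" x] Rpower[of x k] PR by (auto simp: mult.commute)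

lemma prod_notin_P:
  "(\<And>k. k \<in> J \<Longrightarrow> g k \<in> R \<and> g k \<notin> P) \<Longrightarrow> (\<Prod>k\<in>J. g k) \<notin> P"
proof (induction J rule: infinite_finite_induct)
  case (insert x J)
  then have "g x \<in> R" "(\<Prod>k\<in>J. g k) \<in> R" "g x \<notin> P" "(\<Prod>k\<in>J. g k) \<notin> P"
    by (auto intro: Rprod)
  then show ?case using insert.hyps by (simp add: mult_mem_P_iff)
qed (auto simp: P1)

lemma invertible_mod_P:
  assumes "finite C" "C \<subseteq> R" "\<And>x. x \<in> R \<Longrightarrow> \<exists>c\<in>C. x - c \<in> P" "t \<in> R" "t \<notin> P"
  shows "\<exists>t'\<in>R. 1 - t * t' \<in> P"
proof -
  obtain i j where ij: "i < j" "t ^ j - t ^ i \<in> P"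
    using pigeonhole_cover[of C "\<lambda>k. t ^ k" P] assms Pdiff Rpower by blast
  have "t ^ j = t ^ i * (t * t ^ (j - i - 1))"
    using ij(1) by (simp add: power_add[symmetric] power_Suc[symmetric] del: power_Suc)
  then have "t ^ i * (1 - t * t ^ (j - i - 1)) = - (t ^ j - t ^ i)"
    by (simp add: algebra_simps)
  then have "t ^ i * (1 - t * t ^ (j - i - 1)) \<in> P" using ij(2) Pminus by metis
  then have "1 - t * t ^ (j - i - 1) \<in> P"
    using power_mem_P[of t i] assms by (auto simp: mult_mem_P_iff Rpower Rdiff Rmult R1)
  then show ?thesis using assms Rpower by blast
qed

text \<open>
  Under the hypotheses, \<open>P\<close> is generated by a single element \<open>\<pi>\<close> up to denominators outside \<open>P\<close>. The
  proof finds an element \<open>x = b' / a\<close> outside \<open>R\<close> such that \<open>x P\<close> lies in \<open>R\<close>. If \<open>x P\<close> were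
  contained in \<open>P\<close>, all powers of \<open>x\<close> would lie in \<open>(1/a) R\<close>, so two of them would be congruent modulo
  \<open>R\<close> and \<open>x\<close> would be integral over \<open>R\<close>. The hypothesis \<open>closed\<close> is the instance of integral
  closedness that this needs. Hence some \<open>s = x \<pi>\<close> with \<open>\<pi> \<in> P\<close> lies outside \<open>P\<close>, and
  \<open>s y = \<pi> (x y)\<close> for \<open>y \<in> P\<close>.
\<close>
lemma exists_local_uniformizer:
  assumes a: "a \<in> P" "a \<noteq> 0"
    and F: "finite F" "F \<subseteq> R" "\<And>x. x \<in> R \<Longrightarrow> \<exists>f\<in>F. x - f \<in> (*) a ` R"
    and closed: "\<And>x i j. a * x \<in> R \<Longrightarrow> i < j \<Longrightarrow> x ^ j - x ^ i \<in> R \<Longrightarrow> x \<in> R"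
  shows "\<exists>\<pi>\<in>P. \<pi> \<noteq> 0 \<and> (\<exists>s\<in>R. s \<notin> P \<and> (\<forall>y\<in>P. \<exists>w\<in>R. s * y = \<pi> * w))"
proof -
  define aR where "aR = (*) a ` R"
  have aR_R: "a \<in> R" using a PR by blast
  have aR_add: "x + y \<in> aR" if "x \<in> aR" "y \<in> aR" for x y
    using that unfolding aR_def by (auto simp: distrib_left[symmetric] intro: Radd)
  have aR_mult: "r * x \<in> aR" if "r \<in> R" "x \<in> aR" for r x
    using that unfolding aR_def by (auto simp: mult.left_commute intro!: Rmult)
  have aR_minus: "- x \<in> aR" if "x \<in> aR" for x
    using aR_mult[of "- 1" x] that R1 Rminus by simp
  have aR_diff: "x - y \<in> aR" if "x \<in> aR" "y \<in> aR" for x y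
    using aR_add[of x "- y"] aR_minus that by simp
  have aR_P: "aR \<subseteq> P" using a Pmult unfolding aR_def by (auto simp: mult.commute)
  have F': "\<exists>f\<in>F. x - f \<in> aR" if "x \<in> R" for x using F(3) that by (simp add: aR_def)
  \<comment> \<open>Among the elements whose annihilator modulo \<open>a\<close> lies in \<open>P\<close>, choose \<open>b\<close> with a maximal annihilator.\<close>
  define Ann where "Ann b = {z \<in> R. z * b \<in> aR}" for b
  define \<mu> where "\<mu> b = card (F \<inter> Ann b)" for b
  obtain b where b: "b \<in> R" "Ann b \<subseteq> P" and bmax: "\<And>c. c \<in> R \<Longrightarrow> Ann c \<subseteq> P \<Longrightarrow> \<mu> c \<le> \<mu> b"
  proof -
    have "1 \<in> R \<and> Ann 1 \<subseteq> P" using R1 aR_P by (auto simp: Ann_def)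
    moreover have "\<mu> c < Suc (card F)" for c
      using card_mono[OF F(1), of "F \<inter> Ann c"] by (simp add: \<mu>_def less_Suc_eq_le)
    ultimately show thesis
      using ex_has_greatest_nat[of "\<lambda>c. c \<in> R \<and> Ann c \<subseteq> P" 1 \<mu> "Suc (card F)"] that by blast
  qed
  have "\<exists>s. s \<in> R \<and> s \<notin> P \<and> s * (b * y) \<in> aR" if y: "y \<in> P" for y
  proof (rule ccontr)
    assume "\<not> ?thesis"
    then have sub: "Ann (b * y) \<subseteq> P" by (auto simp: Ann_def)
    have yR: "y \<in> R" using y PR by blast
    have incl: "Ann b \<subseteq> Ann (b * y)"
    proof
      fix z assume "z \<in> Ann b"
      then have "z \<in> R" "y * (z * b) \<in> aR" using aR_mult[OF yR] by (auto simp: Ann_def)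
      then show "z \<in> Ann (b * y)" by (simp add: Ann_def mult_ac)
    qed
    have "\<mu> (b * y) \<le> \<mu> b" using b yR sub by (intro bmax Rmult)
    then have eqF: "F \<inter> Ann b = F \<inter> Ann (b * y)"
      using F(1) incl unfolding \<mu>_def by (intro card_seteq) auto
    have cancel: "z * b \<in> aR" if z: "z \<in> R" "z * (b * y) \<in> aR" for z
    proof -
      obtain f where f: "f \<in> F" "z - f \<in> aR" using F' z by blast
      have fR: "f \<in> R" using f F by blast
      have "b * y * (z - f) \<in> aR" using f b yR by (intro aR_mult Rmult)
      then have "z * (b * y) - b * y * (z - f) \<in> aR" using z by (intro aR_diff)
      then have "f * (b * y) \<in> aR" by (simp add: algebra_simps)
      then have "f \<in> Ann b" using f fR eqF by (auto simp: Ann_def)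
      then have "f * b \<in> aR" by (simp add: Ann_def)
      then have "b * (z - f) + f * b \<in> aR" using aR_mult[OF b(1) f(2)] by (intro aR_add)
      then show ?thesis by (simp add: algebra_simps)
    qed
    have cancel_power: "z * b \<in> aR" if "z \<in> R" "z * (b * y ^ k) \<in> aR" for z k
      using that
    proof (induction k arbitrary: z)
      case (Suc k)
      have "(z * y) * b \<in> aR"
        using Suc.prems Suc.IH[of "z * y"] yR by (simp add: mult_ac Rmult)
      then show ?case using cancel[of z] Suc.prems by (simp add: mult_ac)
    qed simp
    \<comment> \<open>Multiplication by \<open>y\<close> is injective on multiples of \<open>b\<close> modulo \<open>a\<close>, and two powers of \<open>y\<close> agree modulo \<open>a\<close>.\<close>
    obtain i j where ij: "i < j" "y ^ j - y ^ i \<in> aR"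
      using pigeonhole_cover[of F "\<lambda>k. y ^ k" aR] F(1) F' aR_diff Rpower[OF yR] by blast
    obtain k where k: "j = i + Suc k" using ij(1) less_iff_Suc_add by (metis add_Suc_right)
    have "- b * (y ^ j - y ^ i) \<in> aR" using ij b by (intro aR_mult Rminus)
    also have "- b * (y ^ j - y ^ i) = (1 - y ^ Suc k) * (b * y ^ i)"
      unfolding k by (simp add: power_add algebra_simps)
    finally have "(1 - y ^ Suc k) * b \<in> aR"
      by (rule cancel_power[rotated]) (intro Rdiff R1 Rpower yR)
    then have "1 - y ^ Suc k \<in> P" using b Rdiff[OF R1 Rpower[OF yR, of "Suc k"]]
      by (auto simp: Ann_def simp del: power_Suc)
    then have "(1 - y ^ Suc k) + y ^ Suc k \<in> P" using power_Suc_mem_P[OF y] by (rule Padd)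
    then show False using P1 by simp
  qed
  then obtain \<sigma> where \<sigma>: "\<And>y. y \<in> P \<Longrightarrow> \<sigma> y \<in> R \<and> \<sigma> y \<notin> P \<and> \<sigma> y * (b * y) \<in> aR" by metis
  \<comment> \<open>One multiplier outside \<open>P\<close> serves for all of \<open>P\<close>, as \<open>P\<close> has finitely many classes modulo \<open>a\<close>.\<close>
  define b' where "b' = b * (\<Prod>f\<in>F \<inter> P. \<sigma> f)"
  have prodR: "(\<Prod>f\<in>F \<inter> P. \<sigma> f) \<in> R" "(\<Prod>f\<in>F \<inter> P. \<sigma> f) \<notin> P"
    using \<sigma> by (auto intro!: Rprod prod_notin_P)
  have b'R: "b' \<in> R" using b prodR by (auto simp: b'_def intro: Rmult)
  have b'_notin: "b' \<notin> aR"
  proof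
    assume "b' \<in> aR"
    then have "(\<Prod>f\<in>F \<inter> P. \<sigma> f) \<in> Ann b" using prodR by (auto simp: Ann_def b'_def mult.commute)
    then show False using b prodR by blast
  qed
  have b'_ann: "b' * y \<in> aR" if y: "y \<in> P" for y
  proof -
    have yR: "y \<in> R" using y PR by blast
    obtain f where f: "f \<in> F" "y - f \<in> aR" using F' yR by blast
    have "y - f \<in> P" using f aR_P by blast
    with y have "y - (y - f) \<in> P" by (rule Pdiff)
    then have fP: "f \<in> F \<inter> P" using f by simp
    have "b' * f = (\<Prod>f\<in>F \<inter> P - {f}. \<sigma> f) * (\<sigma> f * (b * f))"
      using F(1) fP by (simp add: b'_def prod.remove[of "F \<inter> P" f] mult_ac)
    also have "\<dots> \<in> aR" using \<sigma> fP by (intro aR_mult[of "\<Prod>f\<in>F \<inter> P - {f}. \<sigma> f"] Rprod) blast+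
    finally have "b' * f + b' * (y - f) \<in> aR" using aR_mult[OF b'R f(2)] by (rule aR_add)
    then show ?thesis by (simp add: algebra_simps)
  qed
  define x where "x = b' / a"
  have ax: "a * x = b'" using a by (simp add: x_def)
  have xP: "x * y \<in> R" if y: "y \<in> P" for y
  proof -
    obtain r where "r \<in> R" "b' * y = a * r" using b'_ann[OF y] by (auto simp: aR_def)
    then show ?thesis using a by (simp add: x_def field_simps)
  qed
  have "\<exists>\<pi>\<in>P. x * \<pi> \<notin> P"
  proof (rule ccontr)
    assume "\<not> ?thesis"
    then have stable: "\<And>y. y \<in> P \<Longrightarrow> x * y \<in> P" by blast
    have "x ^ k * a \<in> P" for k
      by (induction k) (use a stable in \<open>auto simp: mult.assoc\<close>)
    then obtain i j where ij: "i < j" "x ^ j * a - x ^ i * a \<in> aR"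
      using pigeonhole_cover[of F "\<lambda>k. x ^ k * a" aR] F(1) F' aR_diff PR by blast
    then obtain r where "r \<in> R" "x ^ j * a - x ^ i * a = a * r" by (auto simp: aR_def)
    then have "a * (x ^ j - x ^ i) = a * r" "r \<in> R" by (simp_all add: algebra_simps)
    then have "x ^ j - x ^ i \<in> R" using a by simp
    then have "x \<in> R" using closed[of x i j] ax b'R ij by simp
    then show False using b'_notin ax by (auto simp: aR_def)
  qed
  then obtain \<pi> where \<pi>: "\<pi> \<in> P" "x * \<pi> \<notin> P" by blast
  moreover have "x * \<pi> * y = \<pi> * (x * y)" for y by (simp add: mult_ac)
  ultimately show ?thesis using xP P0
    by (intro bexI[of _ \<pi>] conjI bexI[of _ "x * \<pi>"]) (auto intro!: bexI)
qed

end

section \<open>Valuations defined by the powers of a locally principal prime ideal\<close>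

text \<open>
  The element \<open>\<pi>\<close> generates \<open>P\<close> up to denominators outside \<open>P\<close>, and \<open>C\<close> contains representatives of
  all classes modulo \<open>P\<close>.
\<close>
locale local_uniformizer = subring_with_prime R P for R P :: "'a::field set" +
  fixes \<pi> :: 'a and C :: "'a set" and q :: nat
  assumes piP: "\<pi> \<in> P" and pi0: "\<pi> \<noteq> 0"
    and local_principal: "\<exists>s\<in>R. s \<notin> P \<and> (\<forall>y\<in>P. \<exists>w\<in>R. s * y = \<pi> * w)"
    and C: "finite C" "C \<subseteq> R" "card C \<le> q" "x \<in> R \<Longrightarrow> \<exists>c\<in>C. x - c \<in> P"
begin

lemma piR: "\<pi> \<in> R" using piP PR by blast

lemma Pinv: "t \<in> R \<Longrightarrow> t \<notin> P \<Longrightarrow> \<exists>t'\<in>R. 1 - t * t' \<in> P"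
  using invertible_mod_P C by blast

text \<open>
  The elements of \<open>R\<close> that are divisible by \<open>\<pi> ^ k\<close> up to a denominator outside \<open>P\<close>. This is the
  \<open>k\<close>-th power of the ideal \<open>P\<close>, see \<open>ideal_power_eq_pow_ideal\<close> below.
\<close>
definition pow_ideal :: "nat \<Rightarrow> 'a set" where
  "pow_ideal k = {x \<in> R. \<exists>t\<in>R. t \<notin> P \<and> (\<exists>z\<in>R. t * x = \<pi> ^ k * z)}"

lemma pow_idealI: "x \<in> R \<Longrightarrow> t \<in> R \<Longrightarrow> t \<notin> P \<Longrightarrow> z \<in> R \<Longrightarrow> t * x = \<pi> ^ k * z \<Longrightarrow> x \<in> pow_ideal k"
  by (auto simp: pow_ideal_def)

lemma pow_idealE:
  assumes "x \<in> pow_ideal k"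
  obtains t z where "x \<in> R" "t \<in> R" "t \<notin> P" "z \<in> R" "t * x = \<pi> ^ k * z"
  using assms by (auto simp: pow_ideal_def)

lemma pow_ideal_0: "pow_ideal 0 = R"
  using R1 P1 by (auto simp: pow_ideal_def)

lemma zero_pow_ideal: "0 \<in> pow_ideal k"
  using R0 R1 P1 by (intro pow_idealI[of _ 1 0]) auto

lemma pi_power_pow_ideal: "\<pi> ^ k \<in> pow_ideal k"
  using R1 P1 Rpower[OF piR] by (intro pow_idealI[of _ 1 1]) auto

lemma pow_ideal_add:
  assumes "x \<in> pow_ideal k" "y \<in> pow_ideal k"
  shows "x + y \<in> pow_ideal k"
proof -
  obtain t z where x: "x \<in> R" "t \<in> R" "t \<notin> P" "z \<in> R" "t * x = \<pi> ^ k * z"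
    using assms(1) by (rule pow_idealE)
  obtain u w where y: "y \<in> R" "u \<in> R" "u \<notin> P" "w \<in> R" "u * y = \<pi> ^ k * w"
    using assms(2) by (rule pow_idealE)
  have "t * u * (x + y) = u * (t * x) + t * (u * y)" by (simp add: algebra_simps)
  also have "\<dots> = \<pi> ^ k * (u * z + t * w)" unfolding x y by (simp add: algebra_simps)
  finally show ?thesis using x y
    by (intro pow_idealI[of _ "t * u" "u * z + t * w"]) (auto intro: Radd Rmult simp: mult_mem_P_iff)
qed

lemma pow_ideal_mult:
  assumes "x \<in> pow_ideal k" "y \<in> pow_ideal l"
  shows "x * y \<in> pow_ideal (k + l)"
proof -
  obtain t z where x: "x \<in> R" "t \<in> R" "t \<notin> P" "z \<in> R" "t * x = \<pi> ^ k * z"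
    using assms(1) by (rule pow_idealE)
  obtain u w where y: "y \<in> R" "u \<in> R" "u \<notin> P" "w \<in> R" "u * y = \<pi> ^ l * w"
    using assms(2) by (rule pow_idealE)
  have "t * u * (x * y) = (t * x) * (u * y)" by (simp add: algebra_simps)
  also have "\<dots> = \<pi> ^ (k + l) * (z * w)" unfolding x y by (simp add: algebra_simps power_add)
  finally show ?thesis using x y
    by (intro pow_idealI[of _ "t * u" "z * w"]) (auto intro: Rmult simp: mult_mem_P_iff)
qed

lemma pow_ideal_smult: "r \<in> R \<Longrightarrow> x \<in> pow_ideal k \<Longrightarrow> r * x \<in> pow_ideal k"
  using pow_ideal_mult[of r 0 x k] by (simp add: pow_ideal_0)

lemma pow_ideal_minus: "x \<in> pow_ideal k \<Longrightarrow> - x \<in> pow_ideal k"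
  using pow_ideal_smult[of "- 1" x k] R1 Rminus by simp

lemma pow_ideal_diff: "x \<in> pow_ideal k \<Longrightarrow> y \<in> pow_ideal k \<Longrightarrow> x - y \<in> pow_ideal k"
  using pow_ideal_add[of x k "- y"] pow_ideal_minus by simp

lemma pow_ideal_antimono:
  assumes "l \<le> k" shows "pow_ideal k \<subseteq> pow_ideal l"
proof
  fix x assume "x \<in> pow_ideal k"
  then obtain t z where x: "x \<in> R" "t \<in> R" "t \<notin> P" "z \<in> R" "t * x = \<pi> ^ k * z"
    by (rule pow_idealE)
  have "\<pi> ^ k = \<pi> ^ l * \<pi> ^ (k - l)" using assms by (simp add: power_add[symmetric])
  then show "x \<in> pow_ideal l"
    using x by (intro pow_idealI[of _ t "\<pi> ^ (k - l) * z"]) (auto intro: Rmult Rpower piR)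
qed

lemma pow_ideal_cancel:
  assumes "u \<in> R" "u \<notin> P" "x \<in> R" "u * x \<in> pow_ideal k"
  shows "x \<in> pow_ideal k"
proof -
  obtain t z where "t \<in> R" "t \<notin> P" "z \<in> R" "t * (u * x) = \<pi> ^ k * z"
    using assms(4) by (rule pow_idealE)
  then show ?thesis using assms
    by (intro pow_idealI[of _ "t * u" z]) (auto intro: Rmult simp: mult_mem_P_iff mult.assoc)
qed

lemma pow_ideal_1: "pow_ideal 1 = P"
proof (intro subset_antisym subsetI)
  fix x assume "x \<in> pow_ideal 1"
  then obtain t z where x: "x \<in> R" "t \<in> R" "t \<notin> P" "z \<in> R" "t * x = \<pi> * z"
    by (auto elim!: pow_idealE)
  then have "t * x \<in> P" using Pmult[OF x(4) piP] by (simp add: mult.commute)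
  then show "x \<in> P" using Pprime x by blast
next
  fix x assume "x \<in> P"
  then obtain s w where "s \<in> R" "s \<notin> P" "w \<in> R" "s * x = \<pi> * w" using local_principal by blast
  then show "x \<in> pow_ideal 1" using \<open>x \<in> P\<close> PR by (intro pow_idealI[of x s w]) auto
qed

text \<open>
  Both summands are visibly in the product of the \<open>k\<close>-th power of \<open>P\<close> with \<open>P\<close>.
\<close>
lemma pow_ideal_SucE:
  assumes "x \<in> pow_ideal (Suc k)"
  obtains z y p where "z \<in> R" "y \<in> pow_ideal k" "p \<in> P" "x = \<pi> ^ k * (\<pi> * z) + y * p"
proof -
  obtain t z where x: "x \<in> R" "t \<in> R" "t \<notin> P" "z \<in> R" "t * x = \<pi> ^ Suc k * z"
    using assms by (rule pow_idealE)
  obtain t' where t': "t' \<in> R" "1 - t * t' \<in> P" using Pinv x by blast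
  have "x = t' * (t * x) + x * (1 - t * t')" by (simp add: algebra_simps)
  also have "t' * (t * x) = \<pi> ^ k * (\<pi> * (z * t'))" unfolding x by (simp add: algebra_simps)
  finally show thesis using that[of "z * t'" x "1 - t * t'"] x t' assms
      pow_ideal_antimono[of k "Suc k"] by (auto intro: Rmult)
qed

text \<open>
  The valuation of \<open>x\<close> at \<open>P\<close> is \<open>k\<close>.
\<close>
definition exact_val :: "nat \<Rightarrow> 'a \<Rightarrow> bool" where
  "exact_val k x \<longleftrightarrow> x \<in> pow_ideal k \<and> x \<notin> pow_ideal (Suc k)"

lemma exact_valE:
  assumes "exact_val k x"
  obtains t z where "x \<in> R" "t \<in> R" "t \<notin> P" "z \<in> R" "z \<notin> P" "t * x = \<pi> ^ k * z"
proof -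
  obtain t z where x: "x \<in> R" "t \<in> R" "t \<notin> P" "z \<in> R" "t * x = \<pi> ^ k * z"
    using assms pow_idealE unfolding exact_val_def by metis
  have "z \<notin> P"
  proof
    assume z: "z \<in> P"
    obtain s where s: "s \<in> R" "s \<notin> P" "\<forall>y\<in>P. \<exists>w\<in>R. s * y = \<pi> * w" using local_principal by blast
    then obtain w where w: "w \<in> R" "s * z = \<pi> * w" using z by blast
    have "s * t * x = \<pi> ^ k * (s * z)" using x by (simp add: algebra_simps)
    then have "s * t * x = \<pi> ^ Suc k * w" unfolding w by simp
    then have "x \<in> pow_ideal (Suc k)" using x s w by (intro pow_idealI[of _ "s * t" w]) (auto intro: Rmult simp: mult_mem_P_iff)
    then show False using assms by (simp add: exact_val_def)
  qed
  then show thesis using that x by blast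
qed

lemma exact_val_mult:
  assumes "exact_val k x" "exact_val l y"
  shows "exact_val (k + l) (x * y)"
proof -
  obtain t z where x: "x \<in> R" "t \<in> R" "t \<notin> P" "z \<in> R" "z \<notin> P" "t * x = \<pi> ^ k * z"
    using assms(1) by (rule exact_valE)
  obtain u w where y: "y \<in> R" "u \<in> R" "u \<notin> P" "w \<in> R" "w \<notin> P" "u * y = \<pi> ^ l * w"
    using assms(2) by (rule exact_valE)
  have "x * y \<notin> pow_ideal (Suc (k + l))"
  proof
    assume "x * y \<in> pow_ideal (Suc (k + l))"
    then obtain v a where v: "v \<in> R" "v \<notin> P" "a \<in> R" "v * (x * y) = \<pi> ^ Suc (k + l) * a"
      by (auto elim: pow_idealE)
    have "\<pi> ^ (k + l) * (v * (z * w)) = v * ((t * x) * (u * y))"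
      unfolding x y by (simp add: power_add algebra_simps)
    also have "\<dots> = t * u * (v * (x * y))" by (simp add: algebra_simps)
    also have "\<dots> = \<pi> ^ (k + l) * (t * u * a * \<pi>)" unfolding v by (simp add: algebra_simps)
    finally have "v * (z * w) = t * u * a * \<pi>" using pi0 by simp
    moreover have "t * u * a * \<pi> \<in> P" using x y v by (intro Pmult piP Rmult)
    moreover have "v * (z * w) \<notin> P" using x y v by (simp add: mult_mem_P_iff Rmult)
    ultimately show False by metis
  qed
  then show ?thesis using pow_ideal_mult assms by (auto simp: exact_val_def)
qed

lemma exact_val_one: "exact_val 0 1"
  using R1 P1 pow_ideal_0 pow_ideal_1 by (simp add: exact_val_def)

lemma exact_val_prod:
  assumes "\<And>j. j \<in> J \<Longrightarrow> exact_val (e j) (g j)"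
  shows "exact_val (\<Sum>j\<in>J. e j) (\<Prod>j\<in>J. g j)"
  using assms by (induction J rule: infinite_finite_induct) (auto intro: exact_val_one exact_val_mult)

lemma pow_ideal_prod:
  assumes "\<And>j. j \<in> J \<Longrightarrow> g j \<in> pow_ideal (e j)"
  shows "(\<Prod>j\<in>J. g j) \<in> pow_ideal (\<Sum>j\<in>J. e j)"
  using assms by (induction J rule: infinite_finite_induct)
    (auto intro: pow_ideal_mult simp: pow_ideal_0 R1)

lemma exact_val_diff:
  assumes "exact_val k a" "x \<in> pow_ideal v" "k < v"
  shows "exact_val k (x - a)"
proof -
  have x: "x \<in> pow_ideal k" "x \<in> pow_ideal (Suc k)"
    using assms pow_ideal_antimono[of k v] pow_ideal_antimono[of "Suc k" v] by auto
  have "a \<in> pow_ideal (Suc k)" if "x - a \<in> pow_ideal (Suc k)"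
    using pow_ideal_diff[OF x(2) that] by simp
  then show ?thesis using assms x by (auto simp: exact_val_def intro: pow_ideal_diff)
qed

text \<open>
  Modulo the power with exponent \<open>Suc k\<close>, an element of the power with exponent \<open>k\<close> is congruent to
  \<open>\<pi> ^ k * c\<close> for some \<open>c \<in> C\<close>.
\<close>
lemma exists_residue_cover:
  "\<exists>T. finite T \<and> T \<subseteq> R \<and> card T \<le> q ^ k \<and> (\<forall>x\<in>R. \<exists>t\<in>T. x - t \<in> pow_ideal k)"
proof (induction k)
  case 0
  show ?case using R0 by (intro exI[of _ "{0}"]) (auto simp: pow_ideal_0)
next
  case (Suc k)
  then obtain T where T: "finite T" "T \<subseteq> R" "card T \<le> q ^ k" "\<forall>x\<in>R. \<exists>t\<in>T. x - t \<in> pow_ideal k" by blast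
  define T' where "T' = (\<lambda>(t, c). t + \<pi> ^ k * c) ` (T \<times> C)"
  have "card T' \<le> card (T \<times> C)" unfolding T'_def using T C by (intro card_image_le) auto
  also have "\<dots> \<le> q ^ k * q" using T C by (simp add: card_cartesian_product mult_le_mono)
  finally have "card T' \<le> q ^ Suc k" by (simp add: mult.commute)
  moreover have "T' \<subseteq> R" unfolding T'_def using T C by (auto intro!: Radd Rmult Rpower piR)
  moreover have "\<exists>t\<in>T'. x - t \<in> pow_ideal (Suc k)" if x: "x \<in> R" for x
  proof -
    obtain t where t: "t \<in> T" "x - t \<in> pow_ideal k" using T x by blast
    define y where "y = x - t"
    obtain u z where y: "y \<in> R" "u \<in> R" "u \<notin> P" "z \<in> R" "u * y = \<pi> ^ k * z"
      using t unfolding y_def by (auto elim: pow_idealE)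
    obtain u' where u': "u' \<in> R" "1 - u * u' \<in> P" using Pinv y by blast
    obtain c where c: "c \<in> C" "z * u' - c \<in> P" using C(4)[of "z * u'"] y u' by (auto intro: Rmult)
    have "y - \<pi> ^ k * c = y * (1 - u * u') + \<pi> ^ k * (z * u' - c)"
      using y(5) by (simp add: algebra_simps)
    also have "\<dots> \<in> pow_ideal (k + 1)"
      using t u' c pow_ideal_mult[of _ k _ 1] pi_power_pow_ideal[of k]
      by (intro pow_ideal_add) (auto simp: pow_ideal_1[simplified] y_def)
    finally have "x - (t + \<pi> ^ k * c) \<in> pow_ideal (Suc k)" by (simp add: y_def diff_diff_eq)
    moreover have "t + \<pi> ^ k * c \<in> T'" using t c by (auto simp: T'_def)
    ultimately show ?thesis by blast
  qed
  ultimately show ?case using T C unfolding T'_def by (intro exI[of _ T']) (auto simp: T'_def)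
qed

lemma exists_residue_system:
  "\<exists>T. finite T \<and> T \<subseteq> R \<and> card T \<le> q ^ k \<and> (\<forall>x\<in>R. \<exists>!t. t \<in> T \<and> x - t \<in> pow_ideal k)"
proof -
  obtain T where T: "finite T" "T \<subseteq> R" "card T \<le> q ^ k" "\<forall>x\<in>R. \<exists>t\<in>T. x - t \<in> pow_ideal k"
    using exists_residue_cover[of k] by blast
  define \<rho> where "\<rho> x = (SOME t. t \<in> T \<and> x - t \<in> pow_ideal k)" for x
  have \<rho>: "\<rho> x \<in> T" "x - \<rho> x \<in> pow_ideal k" if "x \<in> R" for x
    using someI_ex[of "\<lambda>t. t \<in> T \<and> x - t \<in> pow_ideal k"] T(4) that unfolding \<rho>_def by blast+
  have class_fun: "\<rho> x = \<rho> y" if "x - y \<in> pow_ideal k" for x y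
  proof -
    have "x - t \<in> pow_ideal k \<longleftrightarrow> y - t \<in> pow_ideal k" for t
      using pow_ideal_add[OF that, of "y - t"] pow_ideal_diff[OF _ that, of "x - t"] by auto
    then show ?thesis by (simp add: \<rho>_def)
  qed
  have sub: "\<rho> ` R \<subseteq> T" using \<rho> by blast
  have "card (\<rho> ` R) \<le> q ^ k" using card_mono[OF T(1) sub] T(3) by linarith
  moreover have "\<exists>!t. t \<in> \<rho> ` R \<and> x - t \<in> pow_ideal k" if x: "x \<in> R" for x
  proof (rule ex1I[of _ "\<rho> x"])
    show "\<rho> x \<in> \<rho> ` R \<and> x - \<rho> x \<in> pow_ideal k" using \<rho> x by blast
    fix t assume t: "t \<in> \<rho> ` R \<and> x - t \<in> pow_ideal k"
    then obtain z where z: "z \<in> R" "t = \<rho> z" by blast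
    have "(x - t) - (z - t) \<in> pow_ideal k" using t z \<rho>(2)[OF z(1)] by (intro pow_ideal_diff[of "x - t"]) auto
    then have "x - z \<in> pow_ideal k" by simp
    then show "t = \<rho> x" using class_fun z by simp
  qed
  ultimately show ?thesis using sub T finite_subset by (intro exI[of _ "\<rho> ` R"]) auto
qed

section \<open>Detecting a power of the prime ideal by a product\<close>

text \<open>
  The minimum of \<open>v\<close> and the valuation of \<open>x\<close>, for \<open>x \<in> R\<close>. It depends only on the class of \<open>x\<close>
  modulo the power with exponent \<open>v\<close>.
\<close>
definition trunc_val :: "nat \<Rightarrow> 'a \<Rightarrow> nat" where
  "trunc_val v x = Max {k \<in> {..v}. x \<in> pow_ideal k}"

lemma trunc_val_le_iff:
  assumes "x \<in> R" "k \<le> v"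
  shows "k \<le> trunc_val v x \<longleftrightarrow> x \<in> pow_ideal k"
proof -
  let ?K = "{k \<in> {..v}. x \<in> pow_ideal k}"
  have fin: "finite ?K" "?K \<noteq> {}" using assms pow_ideal_0 by auto
  have "Max ?K \<in> ?K" using fin by (rule Max_in)
  then show ?thesis
    using pow_ideal_antimono[of k "Max ?K"] Max_ge[OF fin(1), of k] assms(2) by (auto simp: trunc_val_def)
qed

lemma trunc_val_le: "x \<in> R \<Longrightarrow> trunc_val v x \<le> v"
  unfolding trunc_val_def using pow_ideal_0 by (subst Max_le_iff) auto

lemma pow_ideal_trunc_val: "x \<in> R \<Longrightarrow> x \<in> pow_ideal (trunc_val v x)"
  using trunc_val_le_iff[OF _ trunc_val_le] by blast

lemma trunc_val_eq_iff: "x \<in> R \<Longrightarrow> trunc_val v x = v \<longleftrightarrow> x \<in> pow_ideal v"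
  using trunc_val_le_iff[of x v v] trunc_val_le[of x v] by auto

lemma exact_val_trunc_val:
  assumes "x \<in> R" "x \<notin> pow_ideal v"
  shows "exact_val (trunc_val v x) x"
proof -
  have "Suc (trunc_val v x) \<le> v" using trunc_val_eq_iff trunc_val_le assms by (simp add: Suc_le_eq le_neq_implies_less)
  then show ?thesis
    using trunc_val_le_iff[of x "Suc (trunc_val v x)" v] pow_ideal_trunc_val assms by (auto simp: exact_val_def)
qed

lemma trunc_val_cong:
  assumes "x - y \<in> pow_ideal v"
  shows "trunc_val v x = trunc_val v y"
proof -
  have "x \<in> pow_ideal k \<longleftrightarrow> y \<in> pow_ideal k" if "k \<le> v" for k
  proof -
    have "x - y \<in> pow_ideal k" using assms that pow_ideal_antimono by blast
    then show ?thesis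
      using pow_ideal_add[of "x - y" k y] pow_ideal_diff[of x k "x - y"] by auto
  qed
  then show ?thesis by (simp add: trunc_val_def cong: conj_cong)
qed

text \<open>
  \<open>B\<close> represents the nonzero classes modulo the power with exponent \<open>v\<close>, and \<open>E\<close> is the sum of the
  valuations of its elements, which are all less than \<open>v\<close>. If \<open>y\<close> is in the power, then \<open>y - b\<close> has
  the same valuation as \<open>b\<close>. In general, let \<open>a\<close> run through representatives of all classes. Then the
  sum of the truncated valuations of \<open>y - a\<close> does not depend on \<open>y\<close>, so it is \<open>v + E\<close>. If \<open>y\<close> is not
  in the power, the zero class contributes less than \<open>v\<close> to this sum, and \<open>B\<close> more than \<open>E\<close>.
\<close>
lemma exists_detecting_product:
  "\<exists>B E. finite B \<and> B \<subseteq> R \<and> card B \<le> q ^ v - 1 \<and>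
     (\<forall>y\<in>R. (y \<in> pow_ideal v \<longrightarrow> exact_val E (\<Prod>b\<in>B. y - b)) \<and>
             (y \<notin> pow_ideal v \<longrightarrow> (\<Prod>b\<in>B. y - b) \<in> pow_ideal (Suc E)))"
proof -
  obtain T where T: "finite T" "T \<subseteq> R" "card T \<le> q ^ v"
    and T_ex1: "\<forall>x\<in>R. \<exists>!t. t \<in> T \<and> x - t \<in> pow_ideal v"
    using exists_residue_system[of v] by blast
  have same: "a = b" if "a \<in> T" "b \<in> T" "a - b \<in> pow_ideal v" for a b
    using T_ex1 that T(2) zero_pow_ideal[of v] by (metis diff_self subsetD)
  obtain a0 where a0: "a0 \<in> T" "a0 \<in> pow_ideal v"
    using T_ex1 R0 pow_ideal_minus[of _ v] by (metis diff_0 minus_minus)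
  define B where "B = T - {a0}"
  define E where "E = (\<Sum>a\<in>B. trunc_val v a)"
  have B_notin: "a \<notin> pow_ideal v" if "a \<in> B" for a
    using same[of a a0] that a0 by (auto simp: B_def intro: pow_ideal_diff)
  have "card B \<le> q ^ v - 1" using T a0 by (simp add: B_def)
  moreover have "exact_val E (\<Prod>b\<in>B. y - b)" if y: "y \<in> pow_ideal v" for y
    unfolding E_def
  proof (intro exact_val_prod)
    fix a assume a: "a \<in> B"
    then have "a \<in> R" using T by (auto simp: B_def)
    then show "exact_val (trunc_val v a) (y - a)"
      using exact_val_trunc_val[of a v] B_notin[OF a] trunc_val_eq_iff[of a v] trunc_val_le[of a v] y
      by (intro exact_val_diff[where v = v]) auto
  qed
  moreover have "(\<Prod>b\<in>B. y - b) \<in> pow_ideal (Suc E)" if y: "y \<in> R" "y \<notin> pow_ideal v" for y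
  proof -
    \<comment> \<open>The permutation \<open>a \<mapsto> y - a\<close> of the residue classes is an involution.\<close>
    define \<sigma> where "\<sigma> a = (THE t. t \<in> T \<and> (y - a) - t \<in> pow_ideal v)" for a
    have \<sigma>: "\<sigma> a \<in> T" "(y - a) - \<sigma> a \<in> pow_ideal v" if "a \<in> T" for a
      using theI'[of "\<lambda>t. t \<in> T \<and> (y - a) - t \<in> pow_ideal v"] T_ex1 T(2) that Rdiff[OF y(1)]
      unfolding \<sigma>_def by blast+
    have invol: "\<sigma> (\<sigma> a) = a" if a: "a \<in> T" for a
    proof (rule same)
      have "((y - a) - \<sigma> a) - ((y - \<sigma> a) - \<sigma> (\<sigma> a)) \<in> pow_ideal v"
        using \<sigma>(2)[OF a] \<sigma>(2)[OF \<sigma>(1)[OF a]] by (rule pow_ideal_diff)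
      then have "- (a - \<sigma> (\<sigma> a)) \<in> pow_ideal v" by (simp add: algebra_simps)
      then show "\<sigma> (\<sigma> a) - a \<in> pow_ideal v" by (simp add: algebra_simps)
    qed (use \<sigma> a in auto)
    have "(\<Sum>a\<in>T. trunc_val v (y - a)) = (\<Sum>a\<in>T. trunc_val v (\<sigma> a))"
      using \<sigma> by (intro sum.cong trunc_val_cong) auto
    also have "\<dots> = (\<Sum>a\<in>T. trunc_val v a)"
      by (rule sum.reindex_bij_witness[of _ \<sigma> \<sigma>]) (use \<sigma> invol in auto)
    also have "\<dots> = v + E"
      using T a0 trunc_val_eq_iff[of a0 v] unfolding E_def B_def by (subst sum.remove[of T a0]) auto
    finally have "trunc_val v (y - a0) + (\<Sum>a\<in>B. trunc_val v (y - a)) = v + E"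
      using T a0 unfolding B_def by (subst (asm) sum.remove[of T a0]) auto
    moreover have "trunc_val v (y - a0) < v"
    proof -
      have "trunc_val v (y - a0) = trunc_val v y" using a0 by (intro trunc_val_cong) (auto intro: pow_ideal_minus)
      then show ?thesis using y trunc_val_eq_iff trunc_val_le le_neq_implies_less by metis
    qed
    ultimately have "Suc E \<le> (\<Sum>a\<in>B. trunc_val v (y - a))" by linarith
    moreover have "(\<Prod>b\<in>B. y - b) \<in> pow_ideal (\<Sum>a\<in>B. trunc_val v (y - a))"
      using T y by (intro pow_ideal_prod pow_ideal_trunc_val Rdiff) (auto simp: B_def)
    ultimately show ?thesis using pow_ideal_antimono by blast
  qed
  ultimately show ?thesis using T by (intro exI[of _ B] exI[of _ E]) (auto simp: B_def)
qed

end

section \<open>Rings of integers of number fields\<close>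

lemma pcompose_coeff_Ints:
  fixes p q :: "'a::comm_ring_1 poly"
  assumes "\<And>i. coeff p i \<in> \<int>" "\<And>i. coeff q i \<in> \<int>"
  shows "coeff (pcompose p q) i \<in> \<int>"
  using assms(1)
proof (induction p arbitrary: i)
  case (pCons a p)
  have a: "a \<in> \<int>" "\<And>i. coeff p i \<in> \<int>"
    using pCons.prems[of 0] pCons.prems[of "Suc _"] by simp_all
  show ?case using assms(2) pCons.IH[OF a(2)] a(1)
    by (auto simp: pcompose_pCons coeff_mult coeff_pCons split: nat.split intro!: Ints_add Ints_sum Ints_mult)
qed simp

text \<open>
  If a monic polynomial \<open>p\<close> with integer coefficients vanishes at \<open>x ^ j - x ^ i\<close>, then the
  composition of \<open>p\<close> with \<open>X ^ j - X ^ i\<close> is monic with integer coefficients and vanishes at \<open>x\<close>.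
\<close>
lemma algebraic_int_if_power_diff:
  fixes x :: "'a::field_char_0"
  assumes "algebraic_int (x ^ j - x ^ i)" "i < j"
  shows "algebraic_int x"
proof -
  obtain p where p: "lead_coeff p = 1" "\<forall>i. coeff p i \<in> \<int>" "poly p (x ^ j - x ^ i) = 0"
    using assms(1) by (auto elim: algebraic_int.cases)
  define q where "q = (monom 1 j - monom 1 i :: 'a poly)"
  have deg: "degree q = j"
    using assms(2) degree_add_eq_left[of "- monom 1 i" "monom (1::'a) j"]
    by (simp add: q_def degree_monom_eq)
  have lead: "lead_coeff q = 1" using assms(2) by (simp add: deg) (simp add: q_def)
  have "lead_coeff (pcompose p q) = 1"
    using lead_coeff_comp[of q p] deg assms(2) p lead by simp
  moreover have "coeff (pcompose p q) k \<in> \<int>" for k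
    by (rule pcompose_coeff_Ints) (use p in \<open>auto simp: q_def intro!: Ints_diff\<close>)
  moreover have "poly (pcompose p q) x = 0"
    using p by (simp add: poly_pcompose q_def poly_monom)
  ultimately show ?thesis by (intro algebraic_int.intros) auto
qed

lemma ring_of_type_algebra_sel [simp]:
  "carrier (ring_of_type_algebra :: 'a::ring_1 ring) = UNIV"
  "x \<otimes>\<^bsub>ring_of_type_algebra\<^esub> y = x * (y::'a)"
  "x \<oplus>\<^bsub>ring_of_type_algebra\<^esub> y = x + (y::'a)"
  "\<one>\<^bsub>ring_of_type_algebra\<^esub> = (1::'a)"
  "\<zero>\<^bsub>ring_of_type_algebra\<^esub> = (0::'a)"
  by (simp_all add: ring_of_type_algebra_def)

lemma finite_dimension_imp_finite_span:
  fixes K :: "'a::field_char_0 set"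
  assumes "ring.finite_dimension (ring_of_type_algebra :: 'a ring) \<rat> K"
  shows "\<exists>B. finite B \<and> K \<subseteq> module.span (\<lambda>(r::rat) x. of_rat r * x) B"
proof -
  interpret A: ring "ring_of_type_algebra :: 'a ring" by (rule ring_from_type_algebra)
  interpret V: vector_space "\<lambda>(r::rat) (x::'a). of_rat r * x"
    by unfold_locales (simp_all add: algebra_simps of_rat_add of_rat_mult)
  obtain n where "A.dimension n \<rat> K" using assms by (auto simp: A.finite_dimension_def)
  then show ?thesis
  proof (induction n "\<rat> :: 'a set" K rule: A.dimension.induct)
    case zero_dim
    show ?case by (rule exI[of _ "{}"]) simp
  next
    case (Suc_dim v E n)
    then obtain B where B: "finite B" "E \<subseteq> V.span B" by blast
    have "A.line_extension \<rat> v E \<subseteq> V.span (insert v B)"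
    proof
      fix x assume "x \<in> A.line_extension \<rat> v E"
      then obtain c y where c: "c \<in> \<rat>" "y \<in> E" "x = c * v + y"
        by (auto simp: A.line_extension_def set_add_def set_mult_def r_coset_def)
      then obtain r where "c = of_rat r" by (auto elim: Rats_cases)
      moreover have "y \<in> V.span (insert v B)" using B c V.span_mono[of B "insert v B"] by blast
      ultimately show "x \<in> V.span (insert v B)"
        using c(3) V.span_add[OF V.span_scale[OF V.span_base[of v "insert v B"], of r]] by simp
    qed
    then show ?case using B by (intro exI[of _ "insert v B"]) auto
  qed
qed

text \<open>
  An integer relation can be divided by \<open>p\<close> until some coefficient is not divisible by \<open>p\<close>.
\<close>
lemma exists_primitive_relation:
  fixes T :: "'a::field_char_0 set" and p :: nat
  assumes "finite T" "(\<Sum>t\<in>T. of_int (c t) * t) = 0" "\<exists>t\<in>T. c t \<noteq> 0" "p > 1"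
  shows "\<exists>c'. (\<Sum>t\<in>T. of_int (c' t) * t) = 0 \<and> (\<exists>t\<in>T. \<not> int p dvd c' t)"
  using assms(2,3)
proof (induction "\<Sum>t\<in>T. nat \<bar>c t\<bar>" arbitrary: c rule: less_induct)
  case less
  show ?case
  proof (cases "\<exists>t\<in>T. \<not> int p dvd c t")
    case True
    then show ?thesis using less.prems by blast
  next
    case False
    define d where "d t = c t div int p" for t
    have cd: "c t = int p * d t" if "t \<in> T" for t using False that by (simp add: d_def)
    have "(\<Sum>t\<in>T. of_int (c t) * t) = of_nat p * (\<Sum>t\<in>T. of_int (d t) * t)"
      by (simp add: sum_distrib_left cd mult.assoc cong: sum.cong)
    then have rel: "(\<Sum>t\<in>T. of_int (d t) * t) = 0" using less.prems(1) assms(4) by simp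
    have nz: "\<exists>t\<in>T. d t \<noteq> 0" using less.prems(2) cd by force
    have le: "nat \<bar>d t\<bar> \<le> nat \<bar>c t\<bar>" if "t \<in> T" for t
      using cd[OF that] assms(4) by (simp add: abs_mult nat_mult_distrib)
    have lt: "nat \<bar>d t\<bar> < nat \<bar>c t\<bar>" if "t \<in> T" "d t \<noteq> 0" for t
      using cd[OF that(1)] assms(4) that(2) by (simp add: abs_mult nat_mult_distrib)
    have "(\<Sum>t\<in>T. nat \<bar>d t\<bar>) < (\<Sum>t\<in>T. nat \<bar>c t\<bar>)"
      using nz le lt assms(1) by (intro sum_strict_mono_ex1) auto
    then show ?thesis using less.hyps[OF _ rel nz] by blast
  qed
qed

lemma finite_dimension_imp_integer_relation:
  fixes K :: "'a::field_char_0 set"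
  assumes "ring.finite_dimension (ring_of_type_algebra :: 'a ring) \<rat> K"
  shows "\<exists>d. \<forall>T. finite T \<longrightarrow> T \<subseteq> K \<longrightarrow> card T > d \<longrightarrow>
           (\<exists>c. (\<Sum>t\<in>T. of_int (c t) * t) = 0 \<and> (\<exists>t\<in>T. c t \<noteq> (0::int)))"
proof -
  interpret V: vector_space "\<lambda>(r::rat) (x::'a). of_rat r * x"
    by unfold_locales (simp_all add: algebra_simps of_rat_add of_rat_mult)
  obtain B where B: "finite B" "K \<subseteq> V.span B" using finite_dimension_imp_finite_span[OF assms] by blast
  have "\<exists>c. (\<Sum>t\<in>T. of_int (c t) * t) = 0 \<and> (\<exists>t\<in>T. c t \<noteq> (0::int))"
    if T: "finite T" "T \<subseteq> K" "card T > card B" for T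
  proof -
    have "V.dependent T" using V.independent_span_bound[OF B(1), of T] T B by auto
    then obtain u where u: "(\<Sum>t\<in>T. of_rat (u t) * t) = 0" "\<exists>t\<in>T. u t \<noteq> 0"
      using V.dependent_finite[OF T(1)] by auto
    define num where "num t = fst (quotient_of (u t))" for t
    define den where "den t = snd (quotient_of (u t))" for t
    have den: "den t > 0" for t by (simp add: den_def quotient_of_denom_pos')
    have un: "u t = of_int (num t) / of_int (den t)" for t
      unfolding num_def den_def by (rule quotient_of_div) simp
    define c where "c t = num t * (\<Prod>s\<in>T - {t}. den s)" for t
    have "of_int (c t) = (of_int (\<Prod>s\<in>T. den s) * of_rat (u t) :: 'a)" if "t \<in> T" for t
      using den[of t] T(1) that
      by (simp add: c_def un prod.remove[of T t] of_rat_divide)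
    then have "(\<Sum>t\<in>T. of_int (c t) * t) = of_int (\<Prod>s\<in>T. den s) * (\<Sum>t\<in>T. of_rat (u t) * t)"
      by (simp add: sum_distrib_left mult.assoc cong: sum.cong)
    then have "(\<Sum>t\<in>T. of_int (c t) * t) = 0" using u by simp
    moreover have "\<exists>t\<in>T. c t \<noteq> 0"
    proof -
      obtain t where t: "t \<in> T" "u t \<noteq> 0" using u by blast
      then have "num t \<noteq> 0" by (auto simp: un)
      moreover have "(\<Prod>s\<in>T - {t}. den s) > 0" using den by (intro prod_pos) auto
      ultimately show ?thesis using t by (auto simp: c_def)
    qed
    ultimately show ?thesis by blast
  qed
  then show ?thesis by blast
qed

lemma (in subring_with_prime) exists_prime_number:
  assumes "finite C" "\<And>x. x \<in> R \<Longrightarrow> \<exists>c\<in>C. x - c \<in> P"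
  shows "\<exists>p::nat. Factorial_Ring.prime p \<and> of_nat p \<in> P"
proof -
  obtain i j :: nat where ij: "i < j" "of_nat j - of_nat i \<in> P"
    using pigeonhole_cover[of C of_nat P] assms Rof_nat Pdiff by blast
  then have "\<exists>m>0. of_nat m \<in> P" by (intro exI[of _ "j - i"]) (simp add: of_nat_diff)
  define m where "m = (LEAST m. m > 0 \<and> of_nat m \<in> P)"
  have m: "m > 0" "of_nat m \<in> P"
    using LeastI_ex[OF \<open>\<exists>m>0. of_nat m \<in> P\<close>] by (simp_all add: m_def)
  have min: "\<not> (k > 0 \<and> of_nat k \<in> P)" if "k < m" for k
    using that unfolding m_def by (rule not_less_Least)
  have "m \<noteq> 1" using m P1 by auto
  then obtain p where p: "Factorial_Ring.prime p" "p dvd m" using prime_factor_nat by blast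
  then obtain k where k: "m = p * k" by auto
  have "k < m" "k > 0" using k m p prime_gt_1_nat[OF p(1)] by auto
  then have "of_nat k \<notin> P" using min by blast
  then have "of_nat p \<in> P" using Pprime[of "of_nat p" "of_nat k"] m k Rof_nat by auto
  then show ?thesis using p by blast
qed

text \<open>
  A maximal subset \<open>T\<close> of \<open>R\<close> that is independent modulo \<open>p\<close> spans \<open>R\<close> modulo \<open>p\<close>. It has at most
  \<open>d\<close> elements, since by the hypothesis \<open>dep\<close> larger sets satisfy a relation that is nontrivial
  modulo \<open>p\<close>.
\<close>
lemma (in subring_with_prime) finite_mod_prime_number:
  fixes p :: nat
  assumes p: "Factorial_Ring.prime p"
    and dep: "\<And>T. finite T \<Longrightarrow> T \<subseteq> R \<Longrightarrow> card T > d \<Longrightarrow>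
           \<exists>c. (\<Sum>t\<in>T. of_int (c t) * t) = 0 \<and> (\<exists>t\<in>T. \<not> int p dvd c t)"
  shows "\<exists>F. finite F \<and> F \<subseteq> R \<and> (\<forall>x\<in>R. \<exists>f\<in>F. x - f \<in> (*) (of_nat p) ` R)"
proof -
  define pR where "pR = (*) (of_nat p) ` R"
  have pR_add: "x + y \<in> pR" if "x \<in> pR" "y \<in> pR" for x y
    using that unfolding pR_def by (auto simp: distrib_left[symmetric] intro: Radd)
  have pR_mult: "r * x \<in> pR" if "r \<in> R" "x \<in> pR" for r x
    using that unfolding pR_def by (auto simp: mult.left_commute intro!: Rmult)
  have pR_diff: "x - y \<in> pR" if "x \<in> pR" "y \<in> pR" for x y
    using pR_add[of x "- 1 * y"] pR_mult[of "- 1" y] R1 Rminus that by simp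
  have pR0: "0 \<in> pR" unfolding pR_def using R0 by (auto intro: image_eqI[of _ _ 0])
  have pR_p: "of_int k * x \<in> pR" if "int p dvd k" "x \<in> R" for k x
    using that unfolding pR_def by (auto simp: mult.assoc intro!: imageI Rmult Rof_int)
  define ind where "ind T \<longleftrightarrow> finite T \<and> T \<subseteq> R \<and>
     (\<forall>c. (\<Sum>t\<in>T. of_int (c t) * t) \<in> pR \<longrightarrow> (\<forall>t\<in>T. int p dvd c t))" for T
  have "ind {}" by (simp add: ind_def)
  moreover have "card T < Suc d" if "ind T" for T
    using dep[of T] that pR0 unfolding ind_def by (metis not_less_eq)
  ultimately obtain T where T: "ind T" and Tmax: "\<And>S. ind S \<Longrightarrow> card S \<le> card T"
    using ex_has_greatest_nat[of ind "{}" card "Suc d"] by blast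
  have finT: "finite T" and TR: "T \<subseteq> R"
    and Tind: "\<And>c. (\<Sum>t\<in>T. of_int (c t) * t) \<in> pR \<Longrightarrow> \<forall>t\<in>T. int p dvd c t"
    using T unfolding ind_def by auto
  have combR: "(\<Sum>t\<in>T. of_int (c t) * t) \<in> R" for c
    using TR by (intro Rsum Rmult Rof_int) auto
  have span: "\<exists>c. x - (\<Sum>t\<in>T. of_int (c t) * t) \<in> pR" if x: "x \<in> R" for x
  proof (cases "x \<in> T")
    case True
    have "(\<Sum>t\<in>T. of_int (if t = x then 1 else 0) * t) = (\<Sum>t\<in>T. if t = x then x else 0)"
      by (intro sum.cong) auto
    also have "\<dots> = x" using True finT by simp
    finally have "x - (\<Sum>t\<in>T. of_int (if t = x then 1 else 0) * t) = 0" by simp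
    then show ?thesis using pR0 by metis
  next
    case False
    have "\<not> ind (insert x T)" using Tmax[of "insert x T"] False finT by auto
    then obtain c where c: "(\<Sum>t\<in>insert x T. of_int (c t) * t) \<in> pR" "\<exists>t\<in>insert x T. \<not> int p dvd c t"
      unfolding ind_def using finT TR x by auto
    define Y where "Y = (\<Sum>t\<in>T. of_int (c t) * t)"
    have sum: "of_int (c x) * x + Y \<in> pR" using c(1) False finT by (simp add: Y_def)
    have "\<not> int p dvd c x"
    proof
      assume dvd: "int p dvd c x"
      have "(of_int (c x) * x + Y) - of_int (c x) * x \<in> pR" using sum pR_p[OF dvd x] by (rule pR_diff)
      then have "\<forall>t\<in>T. int p dvd c t" using Tind[of c] by (simp add: Y_def)
      then show False using c(2) dvd by blast
    qed
    then have "coprime (int p) (c x)" using p by (intro prime_imp_coprime) auto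
    then obtain u v where uv: "u * int p + v * c x = 1" using bezout_int[of "int p" "c x"] by auto
    have "x = of_int (u * int p + v * c x) * x" by (simp add: uv)
    also have "\<dots> = of_int (int p * u) * x + of_int v * (of_int (c x) * x)"
      by (simp add: algebra_simps)
    finally have eq: "x - (\<Sum>t\<in>T. of_int (- v * c t) * t) =
        of_int (int p * u) * x + of_int v * (of_int (c x) * x + Y)"
      by (simp add: Y_def sum_negf sum_distrib_left algebra_simps)
    have "of_int (int p * u) * x + of_int v * (of_int (c x) * x + Y) \<in> pR"
      using pR_p[of "int p * u" x] pR_mult[OF Rof_int sum, of v] x by (intro pR_add) auto
    then show ?thesis using eq by metis
  qed
  define F where "F = (\<lambda>c. \<Sum>t\<in>T. of_int (c t) * t) ` (PiE T (\<lambda>_. {0..<int p}))"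
  have "finite F" unfolding F_def using finT by (intro finite_imageI finite_PiE) auto
  moreover have "F \<subseteq> R" unfolding F_def using combR by auto
  moreover have "\<exists>f\<in>F. x - f \<in> pR" if x: "x \<in> R" for x
  proof -
    obtain c where c: "x - (\<Sum>t\<in>T. of_int (c t) * t) \<in> pR" using span[OF x] by blast
    define c' where "c' = restrict (\<lambda>t. c t mod int p) T"
    have "c' \<in> PiE T (\<lambda>_. {0..<int p})" using prime_gt_0_nat[OF p] by (auto simp: c'_def)
    then have inF: "(\<Sum>t\<in>T. of_int (c' t) * t) \<in> F" by (auto simp: F_def)
    have "(\<Sum>t\<in>T. of_int (c t) * t) - (\<Sum>t\<in>T. of_int (c' t) * t) =
          (\<Sum>t\<in>T. of_int (c t - c t mod int p) * t)"
      by (simp add: c'_def sum_subtractf[symmetric] algebra_simps cong: sum.cong)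
    also have "\<dots> \<in> pR"
      using finT TR
    proof (induction T rule: finite_induct)
      case (insert t T)
      have "of_int (c t - c t mod int p) * t \<in> pR"
        using insert.prems by (intro pR_p dvd_minus_mod) auto
      then show ?case using insert by (auto intro!: pR_add simp del: of_int_diff)
    qed (simp add: pR0)
    finally have "(x - (\<Sum>t\<in>T. of_int (c t) * t)) +
       ((\<Sum>t\<in>T. of_int (c t) * t) - (\<Sum>t\<in>T. of_int (c' t) * t)) \<in> pR" using c by (intro pR_add)
    then show ?thesis using inF by (intro bexI) auto
  qed
  ultimately show ?thesis unfolding pR_def by blast
qed

lemma ring_of_integers_sel [simp]:
  "carrier (ring_of_integers K) = {x \<in> K. algebraic_int x}"
  "x \<otimes>\<^bsub>ring_of_integers K\<^esub> y = x * y"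
  "x \<oplus>\<^bsub>ring_of_integers K\<^esub> y = x + y"
  "\<one>\<^bsub>ring_of_integers K\<^esub> = 1"
  "\<zero>\<^bsub>ring_of_integers K\<^esub> = 0"
  by (simp_all add: ring_of_integers_def)

lemma subring_with_prime_ring_of_integers:
  assumes "primeideal P (ring_of_integers K)"
  shows "subring_with_prime (carrier (ring_of_integers K)) P"
proof -
  define rr where "rr = ring_of_integers K"
  interpret primeideal P rr using assms by (simp add: rr_def)
  have [simp]: "x \<otimes>\<^bsub>rr\<^esub> y = x * y" "x \<oplus>\<^bsub>rr\<^esub> y = x + y" "\<one>\<^bsub>rr\<^esub> = 1" "\<zero>\<^bsub>rr\<^esub> = 0" for x y
    by (simp_all add: rr_def)
  have neg: "- x \<in> carrier rr" if "x \<in> carrier rr" for x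
  proof -
    have "\<ominus>\<^bsub>rr\<^esub> x \<in> carrier rr" "x \<oplus>\<^bsub>rr\<^esub> (\<ominus>\<^bsub>rr\<^esub> x) = \<zero>\<^bsub>rr\<^esub>" using that r_neg by auto
    then show ?thesis by (simp add: add_eq_0_iff)
  qed
  have "1 \<notin> P"
  proof
    assume "1 \<in> P"
    then have "carrier rr = P" using one_imp_carrier by simp
    then show False using I_notcarr by simp
  qed
  then have "subring_with_prime (carrier rr) P"
    using zero_closed one_closed a_closed m_closed neg
      additive_subgroup.zero_closed[OF additive_subgroup_axioms]
      additive_subgroup.a_closed[OF additive_subgroup_axioms]
      I_l_closed I_prime Icarr
    by unfold_locales
      (use ring.ring_simprules(1)[OF ring_axioms] in \<open>auto simp del: ring_of_integers_sel\<close>)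
  then show ?thesis by (simp add: rr_def)
qed

section \<open>Restricted zeros modulo prime powers\<close>

lemma (in local_uniformizer) ideal_power_eq_pow_ideal:
  fixes rr :: "'a ring"
  assumes "carrier rr = R" "\<And>x y. x \<otimes>\<^bsub>rr\<^esub> y = x * y" "\<And>x y. x \<oplus>\<^bsub>rr\<^esub> y = x + y"
  shows "P [^]\<^bsub>ideals_set rr\<^esub> k = pow_ideal k"
proof (induction k)
  case 0
  show ?case by (simp add: nat_pow_def ideals_set_def pow_ideal_0 assms)
next
  case (Suc k)
  have "P [^]\<^bsub>ideals_set rr\<^esub> Suc k = ideal_prod rr (pow_ideal k) P"
    using Suc.IH by (simp add: nat_pow_def ideals_set_def)
  also have "\<dots> = pow_ideal (Suc k)"
  proof (intro subset_antisym subsetI)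
    fix x assume "x \<in> ideal_prod rr (pow_ideal k) P"
    then show "x \<in> pow_ideal (Suc k)"
    proof (induction rule: ideal_prod.induct)
      case (prod i j)
      then show ?case using pow_ideal_mult[of i k j 1] pow_ideal_1 assms by simp
    next
      case (sum s t)
      then show ?case using pow_ideal_add assms by simp
    qed
  next
    fix x assume "x \<in> pow_ideal (Suc k)"
    then obtain z y p where "z \<in> R" "y \<in> pow_ideal k" "p \<in> P" "x = \<pi> ^ k * (\<pi> * z) + y * p"
      by (rule pow_ideal_SucE)
    moreover from this have "\<pi> * z \<in> P" using Pmult[of z \<pi>] piP by (simp add: mult.commute)
    ultimately show "x \<in> ideal_prod rr (pow_ideal k) P"
      using ideal_prod.sum[OF ideal_prod.prod ideal_prod.prod, of "\<pi> ^ k" "pow_ideal k" "\<pi> * z" P y p rr]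
        pi_power_pow_ideal[of k] assms by simp
  qed
  finally show ?case .
qed

lemma residue_representatives:
  assumes "primeideal P (ring_of_integers K)"
    and "card (carrier (ring_of_integers K Quot P)) = q" "q > 0"
  shows "\<exists>C. finite C \<and> C \<subseteq> carrier (ring_of_integers K) \<and> card C \<le> q \<and>
           (\<forall>x\<in>carrier (ring_of_integers K). \<exists>c\<in>C. x - c \<in> P)"
proof -
  define rr where "rr = ring_of_integers K"
  interpret primeideal P rr using assms by (simp add: rr_def)
  interpret S: subring_with_prime "carrier rr" P
    using subring_with_prime_ring_of_integers[OF assms(1)] by (simp only: rr_def)
  have [simp]: "x \<oplus>\<^bsub>rr\<^esub> y = x + y" for x y by (simp add: rr_def)
  have coset: "P +>\<^bsub>rr\<^esub> x = {h + x | h. h \<in> P}" for x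
    by (auto simp: a_r_coset_def r_coset_def)
  define Q where "Q = carrier (rr Quot P)"
  have Q: "Q = {P +>\<^bsub>rr\<^esub> x | x. x \<in> carrier rr}"
    by (auto simp: Q_def FactRing_def A_RCOSETS_def RCOSETS_def a_r_coset_def)
  have finQ: "finite Q" using assms by (metis Q_def rr_def card.infinite less_irrefl)
  define C where "C = (\<lambda>Z. SOME c. c \<in> Z \<and> c \<in> carrier rr) ` Q"
  have some: "(SOME c. c \<in> P +>\<^bsub>rr\<^esub> x \<and> c \<in> carrier rr) \<in> (P +>\<^bsub>rr\<^esub> x) \<inter> carrier rr"
    if "x \<in> carrier rr" for x
  proof -
    have "x \<in> P +>\<^bsub>rr\<^esub> x \<and> x \<in> carrier rr" using S.P0 that by (force simp: coset)
    from someI[of "\<lambda>c. c \<in> P +>\<^bsub>rr\<^esub> x \<and> c \<in> carrier rr", OF this] show ?thesis by blast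
  qed
  have "C \<subseteq> carrier rr" using some unfolding C_def Q by blast
  moreover have "card C \<le> q" unfolding C_def using card_image_le[OF finQ] assms(2) by (simp add: Q_def rr_def)
  moreover have "\<exists>c\<in>C. x - c \<in> P" if x: "x \<in> carrier rr" for x
  proof -
    define c where "c = (SOME c. c \<in> P +>\<^bsub>rr\<^esub> x \<and> c \<in> carrier rr)"
    have "c \<in> C" using x unfolding C_def Q c_def by blast
    moreover obtain h where "h \<in> P" "c = h + x" using some[OF x] unfolding c_def[symmetric] by (auto simp: coset)
    ultimately show ?thesis using S.Pminus[of h] by (intro bexI[of _ c]) auto
  qed
  ultimately show ?thesis using finQ unfolding C_def rr_def by (intro exI[of _ C]) (auto simp: C_def rr_def)
qed

lemma brink_setting_uniformizer:
  assumes "brink_setting K P q n A r v p"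
  shows "\<exists>\<pi> C. local_uniformizer (carrier (ring_of_integers K)) P \<pi> C q"
proof -
  define R where "R = carrier (ring_of_integers K)"
  have prime: "primeideal P (ring_of_integers K)" and nf: "number_field K"
    and "q > 0" and cardq: "card (carrier (ring_of_integers K Quot P)) = q"
    using assms by (auto simp: brink_setting_def prime_gt_0_nat)
  interpret S: subring_with_prime R P
    unfolding R_def by (rule subring_with_prime_ring_of_integers[OF prime])
  obtain C where C: "finite C" "C \<subseteq> R" "card C \<le> q" "\<And>x. x \<in> R \<Longrightarrow> \<exists>c\<in>C. x - c \<in> P"
    using residue_representatives[OF prime cardq \<open>q > 0\<close>] unfolding R_def by blast
  obtain l :: nat where l: "Factorial_Ring.prime l" "of_nat l \<in> P"
    using S.exists_prime_number[OF C(1,4)] by blast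
  obtain d where d: "\<forall>T. finite T \<longrightarrow> T \<subseteq> K \<longrightarrow> card T > d \<longrightarrow>
           (\<exists>c. (\<Sum>t\<in>T. of_int (c t) * t) = 0 \<and> (\<exists>t\<in>T. c t \<noteq> (0::int)))"
    using finite_dimension_imp_integer_relation nf unfolding number_field_def by blast
  have "\<exists>c. (\<Sum>t\<in>T. of_int (c t) * t) = 0 \<and> (\<exists>t\<in>T. \<not> int l dvd c t)"
    if T: "finite T" "T \<subseteq> R" "card T > d" for T
  proof -
    have "T \<subseteq> K" using T(2) by (auto simp: R_def)
    then obtain c where "(\<Sum>t\<in>T. of_int (c t) * t) = 0" "\<exists>t\<in>T. c t \<noteq> (0::int)" using d T by blast
    then show ?thesis using exists_primitive_relation[OF T(1)] prime_gt_1_nat[OF l(1)] by blast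
  qed
  then obtain F where F: "finite F" "F \<subseteq> R" "\<forall>x\<in>R. \<exists>f\<in>F. x - f \<in> (*) (of_nat l) ` R"
    using S.finite_mod_prime_number[OF l(1), of d] by blast
  have "of_nat l \<noteq> (0::'a)" using prime_gt_0_nat[OF l(1)] by simp
  moreover have "x \<in> R" if "of_nat l * x \<in> R" "i < j" "x ^ j - x ^ i \<in> R" for x i j
  proof -
    interpret A: ring "ring_of_type_algebra :: 'a ring" by (rule ring_from_type_algebra)
    have "of_nat l \<in> K" "of_nat l * x \<in> K" using S.Rof_nat[of l] that by (auto simp: R_def)
    then have "x \<in> K"
      using A.subfield_m_inv_simprule[of K "of_nat l" x] nf \<open>of_nat l \<noteq> (0::'a)\<close>
      by (simp add: number_field_def)
    moreover have "algebraic_int x" using algebraic_int_if_power_diff[of x j i] that by (simp add: R_def)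
    ultimately show ?thesis by (simp add: R_def)
  qed
  ultimately obtain \<pi> where "\<pi> \<in> P" "\<pi> \<noteq> 0"
      "\<exists>s\<in>R. s \<notin> P \<and> (\<forall>y\<in>P. \<exists>w\<in>R. s * y = \<pi> * w)"
    using S.exists_local_uniformizer[OF l(2) _ F(1,2)] F(3) by blast
  then have "local_uniformizer R P \<pi> C q" using C by unfold_locales auto
  then show ?thesis unfolding R_def by blast
qed

text \<open>
  All results on number fields are read off from this distribution \<open>y\<close>.
\<close>
lemma brink_setting_distribution:
  assumes setting: "brink_setting K P q n A r v p"
    and ne: "card (restricted_zeros K P n A r v p) \<noteq> 0"
  shows "\<exists>y. (\<forall>i\<in>{1..n}. 1 \<le> y i \<and> y i \<le> card (A i)) \<and>
             (\<Sum>i=1..n. int (card (A i))) \<le> (\<Sum>i=1..n. int (y i)) + weighted_degree q r v p \<and>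
             (\<Prod>i=1..n. y i) \<le> card (restricted_zeros K P n A r v p)"
proof -
  define R where "R = carrier (ring_of_integers K)"
  obtain \<pi> C where "local_uniformizer R P \<pi> C q"
    using brink_setting_uniformizer[OF setting] unfolding R_def by blast
  then interpret local_uniformizer R P \<pi> C q .
  have q: "q > 0" using setting by (auto simp: brink_setting_def prime_gt_0_nat)
  have AR: "A i \<subseteq> R" and Adiff: "\<And>x y. x \<in> A i \<Longrightarrow> y \<in> A i \<Longrightarrow> x \<noteq> y \<Longrightarrow> x - y \<notin> P"
    if "i \<in> {1..n}" for i
    using setting that unfolding brink_setting_def R_def ideal_cong_def by blast+
  have finA: "finite (A i)" if i: "i \<in> {1..n}" for i
  proof -
    obtain h where h: "\<And>x. x \<in> A i \<Longrightarrow> h x \<in> C \<and> x - h x \<in> P" using C(4) AR[OF i] by (metis subsetD)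
    have "inj_on h (A i)"
    proof (rule inj_onI)
      fix x y assume xy: "x \<in> A i" "y \<in> A i" "h x = h y"
      have "(x - h x) - (y - h y) \<in> P" using h xy by (blast intro: Pdiff)
      then show "x = y" using Adiff[OF i] xy by auto
    qed
    then show ?thesis using h C(1) by (meson finite_imageD finite_subset image_subsetI)
  qed
  have pcarr: "p j \<in> mpoly_carrier R n" if "j \<in> {1..r}" for j
    using setting that by (auto simp: brink_setting_def R_def)
  have evalR: "eval_mpoly (p j) x \<in> R" if "j \<in> {1..r}" "x \<in> PiE {1..n} A" for j x
  proof -
    have "x i \<in> R" if "i \<in> {1..n}" for i using AR[OF that] \<open>x \<in> PiE {1..n} A\<close> that by blast
    then show ?thesis unfolding eval_mpoly_def
      using pcarr[OF that(1)] unfolding mpoly_carrier_def by (intro Rsum Rmult Rprod Rpower) blast+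
  qed
  define detects where "detects w B E \<longleftrightarrow> finite B \<and> B \<subseteq> R \<and> card B \<le> q ^ w - 1 \<and>
     (\<forall>y\<in>R. (y \<in> pow_ideal w \<longrightarrow> exact_val E (\<Prod>b\<in>B. y - b)) \<and>
             (y \<notin> pow_ideal w \<longrightarrow> (\<Prod>b\<in>B. y - b) \<in> pow_ideal (Suc E)))" for w B E
  have "\<exists>B E. detects w B E" for w using exists_detecting_product by (simp add: detects_def)
  then have "\<forall>j. \<exists>BE. detects (v j) (fst BE) (snd BE)" by simp
  then obtain BE where BE: "\<And>j. detects (v j) (fst (BE j)) (snd (BE j))"
    using choice[of "\<lambda>j BE. detects (v j) (fst BE) (snd BE)"] by blast
  define B where "B j = fst (BE j)" for j
  define E where "E j = snd (BE j)" for j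
  note BE = BE[folded B_def E_def, unfolded detects_def]
  define g where "g j x = (\<Prod>b\<in>B j. eval_mpoly (p j) x - b)" for j x
  define F where "F x = (\<Prod>j=1..r. g j x)" for x
  define D where "D = (\<Sum>j=1..r. (\<Sum>b\<in>B j. total_degree (p j)))"
  define M where "M = pow_ideal (Suc (\<Sum>j=1..r. E j))"
  have polyF: "polyfun {1..n} D F"
    unfolding D_def F_def[abs_def] g_def
    by (intro polyfun_prod polyfun_diff_const polyfun_eval_mpoly[OF pcarr])
  have FR: "F x \<in> R" if "x \<in> PiE {1..n} A" for x
    unfolding F_def g_def using BE evalR that by (intro Rprod Rdiff) auto
  have zeros: "restricted_zeros K P n A r v p = {x \<in> PiE {1..n} A. F x \<notin> M}"
  proof -
    have "(\<forall>j\<in>{1..r}. eval_mpoly (p j) x \<in> pow_ideal (v j)) \<longleftrightarrow> F x \<notin> M" if x: "x \<in> PiE {1..n} A" for x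
    proof
      assume "\<forall>j\<in>{1..r}. eval_mpoly (p j) x \<in> pow_ideal (v j)"
      then have "exact_val (\<Sum>j=1..r. E j) (F x)"
        unfolding F_def g_def using BE evalR x by (intro exact_val_prod) auto
      then show "F x \<notin> M" by (simp add: exact_val_def M_def)
    next
      assume FM: "F x \<notin> M"
      show "\<forall>j\<in>{1..r}. eval_mpoly (p j) x \<in> pow_ideal (v j)"
      proof (rule ccontr)
        assume "\<not> ?thesis"
        then obtain k where k: "k \<in> {1..r}" "eval_mpoly (p k) x \<notin> pow_ideal (v k)" by blast
        have gE: "g j x \<in> pow_ideal (if j = k then Suc (E j) else E j)" if "j \<in> {1..r}" for j
          using BE[of j] evalR[OF that x] k that pow_ideal_antimono[of "E j" "Suc (E j)"]
          unfolding g_def exact_val_def by auto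
        have "F x \<in> pow_ideal (\<Sum>j=1..r. if j = k then Suc (E j) else E j)"
          unfolding F_def by (intro pow_ideal_prod gE)
        also have "(\<Sum>j=1..r. if j = k then Suc (E j) else E j) = (\<Sum>j=1..r. E j + (if j = k then 1 else 0))"
          by (intro sum.cong) auto
        also have "\<dots> = Suc (\<Sum>j=1..r. E j)" using k by (simp add: sum.distrib)
        finally show False using FM by (simp add: M_def)
      qed
    qed
    then show ?thesis
      unfolding restricted_zeros_def ideal_cong_def
      using ideal_power_eq_pow_ideal[of "ring_of_integers K"] by (auto simp: R_def)
  qed
  have "{x \<in> PiE {1..n} A. F x \<notin> M} \<noteq> {}" using ne unfolding zeros by (metis card.empty)
  then have "\<exists>y. (\<forall>i\<in>{1..n}. 1 \<le> y i \<and> y i \<le> card (A i)) \<and>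
             (\<Sum>i=1..n. card (A i)) \<le> (\<Sum>i=1..n. y i) + D \<and>
             (\<Prod>i=1..n. y i) \<le> card {x \<in> PiE {1..n} A. F x \<notin> M}"
  proof (rule alon_furedi_submodule[where R = R and U = "R - P", rotated -1])
    show "a - b \<in> R - P" if "i \<in> {1..n}" "a \<in> A i" "b \<in> A i" "a \<noteq> b" for i a b
      using Adiff[OF that] AR[OF that(1)] that by (blast intro: Rdiff)
    show "x * y \<in> R - P" if "x \<in> R - P" "y \<in> R - P" for x y
      using that by (simp add: mult_mem_P_iff Rmult)
    show "x \<in> M" if "u \<in> R - P" "x \<in> R" "u * x \<in> M" for u x
      using that unfolding M_def by (blast intro: pow_ideal_cancel)
    show "x + y \<in> M" if "x \<in> M" "y \<in> M" for x y
      using that unfolding M_def by (rule pow_ideal_add)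
    show "c * x \<in> M" if "c \<in> R" "x \<in> M" for c x
      using that unfolding M_def by (rule pow_ideal_smult)
  qed (use finA AR polyF FR R1 P1 Rminus in \<open>auto simp: M_def intro: zero_pow_ideal Rdiff Rmult\<close>)
  then obtain y where y: "\<forall>i\<in>{1..n}. 1 \<le> y i \<and> y i \<le> card (A i)"
      "(\<Sum>i=1..n. card (A i)) \<le> (\<Sum>i=1..n. y i) + D"
      "(\<Prod>i=1..n. y i) \<le> card (restricted_zeros K P n A r v p)"
    unfolding zeros by blast
  have "int D \<le> weighted_degree q r v p"
  proof -
    have "int (card (B j)) \<le> int q ^ v j - 1" for j
    proof -
      have "int (card (B j)) \<le> int (q ^ v j - 1)" using BE[of j] by linarith
      also have "\<dots> = int q ^ v j - 1" using q by (simp add: of_nat_diff)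
      finally show ?thesis .
    qed
    then show ?thesis unfolding D_def weighted_degree_def by (simp add: sum_mono mult_right_mono)
  qed
  moreover have "int (\<Sum>i=1..n. card (A i)) \<le> int ((\<Sum>i=1..n. y i) + D)" using y(2) by linarith
  ultimately have "(\<Sum>i=1..n. int (card (A i))) \<le> (\<Sum>i=1..n. int (y i)) + weighted_degree q r v p"
    by simp
  then show ?thesis using y by blast
qed

section \<open>Minimal products of distributions\<close>

lemma exists_smaller_distribution:
  fixes y :: "'i \<Rightarrow> nat"
  assumes "finite I" "\<And>i. i \<in> I \<Longrightarrow> 1 \<le> y i" "card I \<le> N" "N \<le> (\<Sum>i\<in>I. y i)"
  shows "\<exists>y'. (\<forall>i\<in>I. 1 \<le> y' i \<and> y' i \<le> y i) \<and> (\<Sum>i\<in>I. y' i) = N"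
  using assms(2,4)
proof (induction "\<Sum>i\<in>I. y i" arbitrary: y rule: less_induct)
  case less
  show ?case
  proof (cases "(\<Sum>i\<in>I. y i) = N")
    case True
    then show ?thesis using less.prems by (intro exI[of _ y]) auto
  next
    case False
    have "\<exists>i\<in>I. y i > 1"
    proof (rule ccontr)
      assume "\<not> ?thesis"
      then have "(\<Sum>i\<in>I. y i) \<le> (\<Sum>i\<in>I. 1)" by (intro sum_mono) auto
      then show False using False less.prems(2) assms(3) by simp
    qed
    then obtain i where i: "i \<in> I" "y i > 1" by blast
    define z where "z = y(i := y i - 1)"
    have sum: "(\<Sum>k\<in>I. y k) = Suc (\<Sum>k\<in>I. z k)"
      using assms(1) i by (simp add: sum.remove[of I i] z_def)
    have "1 \<le> z k" if "k \<in> I" for k using less.prems(1)[OF that] i by (auto simp: z_def)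
    moreover have "N \<le> (\<Sum>k\<in>I. z k)" using sum False less.prems(2) by linarith
    ultimately obtain y' where y': "\<forall>k\<in>I. 1 \<le> y' k \<and> y' k \<le> z k" "(\<Sum>k\<in>I. y' k) = N"
      using less.hyps[of z] sum by auto
    have "y' k \<le> y k" if "k \<in> I" for k
      using y'(1) that by (cases "k = i") (auto simp: z_def dest!: bspec[of _ _ k])
    then show ?thesis using y' by blast
  qed
qed

lemma min_distribution_le:
  assumes y: "\<And>i. i \<in> {1..n} \<Longrightarrow> 1 \<le> y i \<and> y i \<le> a i"
    and N: "N \<le> (\<Sum>i=1..n. int (y i))"
  shows "min_distribution n a N \<le> (\<Prod>i=1..n. y i)"
proof (cases "N < int n")
  case True
  have "(\<Prod>i=1..n. 1) \<le> (\<Prod>i=1..n. y i)" using y by (intro prod_mono) auto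
  then show ?thesis using True by (simp add: min_distribution_def)
next
  case False
  have "(\<Sum>i=1..n. int (y i)) \<le> (\<Sum>i=1..n. int (a i))" using y by (intro sum_mono) auto
  then have le: "\<not> N > (\<Sum>i=1..n. int (a i))" using N by linarith
  obtain k where k: "N = int k" using False nonneg_int_cases[of N] by auto
  have "int k \<le> int (\<Sum>i=1..n. y i)" using N k by simp
  then have "k \<le> (\<Sum>i=1..n. y i)" by linarith
  then obtain y' where y': "\<forall>i\<in>{1..n}. 1 \<le> y' i \<and> y' i \<le> y i" "(\<Sum>i=1..n. y' i) = k"
    using exists_smaller_distribution[of "{1..n}" y k] y False k by auto
  define Z where "Z = {\<Prod>i=1..n. y i | y. (\<forall>i\<in>{1..n}. 1 \<le> y i \<and> y i \<le> a i) \<and>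
                                   (\<Sum>i=1..n. int (y i)) = N}"
  have "Z \<subseteq> {..\<Prod>i=1..n. a i}" unfolding Z_def by (auto intro!: prod_mono)
  then have "finite Z" by (rule finite_subset) simp
  have "y' i \<le> a i" if "i \<in> {1..n}" for i using y'(1) y that le_trans by blast
  moreover have "(\<Sum>i=1..n. int (y' i)) = N" using y'(2) k by (metis of_nat_sum)
  ultimately have "(\<Prod>i=1..n. y' i) \<in> Z" unfolding Z_def using y'(1) by blast
  then have "Min Z \<le> (\<Prod>i=1..n. y' i)" using \<open>finite Z\<close> by (intro Min_le)
  also have "\<dots> \<le> (\<Prod>i=1..n. y i)" using y'(1) by (intro prod_mono) auto
  finally show ?thesis using False le unfolding Z_def min_distribution_def by simp
qed

text \<open>
  On \<open>[1, q]\<close>, the logarithm lies above its chord.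
\<close>
lemma ln_chord_le:
  fixes q y :: real
  assumes "1 < q" "1 \<le> y" "y \<le> q"
  shows "(y - 1) / (q - 1) * ln q \<le> ln y"
proof -
  define t where "t = (y - 1) / (q - 1)"
  have t: "0 \<le> t" "t \<le> 1" using assms by (auto simp: t_def)
  have y: "y = 1 + t * (q - 1)" using assms by (simp add: t_def)
  have "ln (q / y) \<le> q / y - 1" "ln (1 / y) \<le> 1 / y - 1"
    using assms by (auto intro!: ln_le_minus_one)
  then have "t * (ln q - ln y) + (1 - t) * (- ln y) \<le> t * (q / y - 1) + (1 - t) * (1 / y - 1)"
    using assms t by (intro add_mono mult_left_mono) (auto simp: ln_div)
  also have "\<dots> = (1 + t * (q - 1)) / y - 1" using assms by (simp add: field_simps)
  also have "\<dots> = 0" using assms y by simp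
  finally have "t * ln q \<le> ln y" by (simp add: algebra_simps)
  then show ?thesis by (simp add: t_def)
qed

text \<open>
  Taking logarithms, \<open>ln_chord_le\<close> bounds each \<open>ln (y i)\<close> below by a linear function of \<open>y i\<close>.
\<close>
lemma power_le_prod_distribution:
  fixes y :: "'i \<Rightarrow> nat" and q k :: nat
  assumes "finite I" "q > 1" "\<And>i. i \<in> I \<Longrightarrow> 1 \<le> y i \<and> y i \<le> q"
    and "k * (q - 1) \<le> (\<Sum>i\<in>I. y i - 1)"
  shows "q ^ k \<le> (\<Prod>i\<in>I. y i)"
proof -
  have pos: "real (y i) > 0" if "i \<in> I" for i using assms(3)[OF that] by simp
  have "real (k * (q - 1)) \<le> real (\<Sum>i\<in>I. y i - 1)" using assms(4) by (simp only: of_nat_le_iff)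
  also have "\<dots> = (\<Sum>i\<in>I. real (y i) - 1)"
    unfolding of_nat_sum using assms(3) by (intro sum.cong) (auto simp: of_nat_diff)
  finally have k: "real k * (real q - 1) \<le> (\<Sum>i\<in>I. real (y i) - 1)" using assms(2) by (simp add: of_nat_diff)
  have "real k \<le> (\<Sum>i\<in>I. real (y i) - 1) / (real q - 1)"
    using k assms(2) by (simp add: pos_le_divide_eq)
  then have "real k * ln (real q) \<le> (\<Sum>i\<in>I. real (y i) - 1) / (real q - 1) * ln (real q)"
    using assms(2) by (intro mult_right_mono) auto
  also have "\<dots> = (\<Sum>i\<in>I. (real (y i) - 1) / (real q - 1) * ln (real q))"
    by (simp add: sum_divide_distrib sum_distrib_right)
  also have "\<dots> \<le> (\<Sum>i\<in>I. ln (real (y i)))"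
    using assms(2,3) by (intro sum_mono ln_chord_le) auto
  also have "\<dots> = ln (\<Prod>i\<in>I. real (y i))" using pos assms(1) by (subst ln_prod) auto
  finally have "ln (real q ^ k) \<le> ln (\<Prod>i\<in>I. real (y i))" using assms(2) by (simp add: ln_realpow)
  moreover have "(\<Prod>i\<in>I. real (y i)) > 0" using pos by (intro prod_pos) auto
  ultimately have "real (q ^ k) \<le> real (\<Prod>i\<in>I. y i)" using assms(2) by simp
  then show ?thesis by (simp only: of_nat_le_iff)
qed

section \<open>The bounds for zeros\<close>

lemma warning_second:
  fixes P :: "nat \<Rightarrow> 'f::{field, finite} mpolynomial"
  assumes P: "\<And>j. j \<in> {1..r} \<Longrightarrow> P j \<in> mpoly_carrier UNIV n"
    and deg: "(\<Sum>j=1..r. total_degree (P j)) \<le> n"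
    and ne: "{x \<in> PiE {1..n} (\<lambda>_. UNIV). \<forall>j\<in>{1..r}. eval_mpoly (P j) x = 0} \<noteq> {}"
  shows "card (UNIV :: 'f set) ^ (n - (\<Sum>j=1..r. total_degree (P j)))
           \<le> card {x \<in> PiE {1..n} (\<lambda>_. UNIV). \<forall>j\<in>{1..r}. eval_mpoly (P j) x = 0}"
proof -
  define q where "q = card (UNIV :: 'f set)"
  define d where "d = (\<Sum>j=1..r. total_degree (P j))"
  define B where "B = (UNIV - {0} :: 'f set)"
  define F where "F x = (\<Prod>j=1..r. \<Prod>b\<in>B. eval_mpoly (P j) x - b)" for x
  have cardB: "card B = q - 1" by (simp add: B_def q_def)
  have "card {0, 1 :: 'f} \<le> q" unfolding q_def by (intro card_mono) auto
  then have q: "q > 1" by simp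
  have F0: "(\<forall>j\<in>{1..r}. eval_mpoly (P j) x = 0) \<longleftrightarrow> F x \<notin> {0}" for x
    by (auto simp: F_def B_def)
  have ne': "{x \<in> PiE {1..n} (\<lambda>_. UNIV). F x \<notin> {0}} \<noteq> {}"
    unfolding F0[symmetric] by (rule ne)
  have "polyfun {1..n} (\<Sum>j=1..r. \<Sum>b\<in>B. total_degree (P j)) F"
    unfolding F_def[abs_def] by (intro polyfun_prod polyfun_diff_const polyfun_eval_mpoly[OF P])
  then have polyF: "polyfun {1..n} ((q - 1) * d) F"
    by (simp add: cardB d_def sum_distrib_left)
  have "\<exists>y. (\<forall>i\<in>{1..n}. 1 \<le> y i \<and> y i \<le> card (UNIV :: 'f set)) \<and>
             (\<Sum>i=1..n. card (UNIV :: 'f set)) \<le> (\<Sum>i=1..n. y i) + (q - 1) * d \<and>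
             (\<Prod>i=1..n. y i) \<le> card {x \<in> PiE {1..n} (\<lambda>_. UNIV). F x \<notin> {0}}"
    by (rule alon_furedi_submodule[where R = UNIV and U = "- {0}"])
       (use polyF ne' in simp_all)
  then obtain y where y: "\<forall>i\<in>{1..n}. 1 \<le> y i \<and> y i \<le> q"
    "(\<Sum>i=1..n. q) \<le> (\<Sum>i=1..n. y i) + (q - 1) * d"
    "(\<Prod>i=1..n. y i) \<le> card {x \<in> PiE {1..n} (\<lambda>_. UNIV). F x \<notin> {0}}"
    unfolding q_def[symmetric] by blast
  have "(\<Sum>i=1..n. y i) = (\<Sum>i=1..n. (y i - 1) + 1)" using y(1) by (simp add: Suc_le_eq)
  also have "\<dots> = (\<Sum>i=1..n. y i - 1) + n" by (simp only: sum.distrib) simp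
  finally have "n * q \<le> (\<Sum>i=1..n. y i - 1) + n + (q - 1) * d" using y(2) by simp
  moreover have "n * q = n * (q - 1) + n" using q by (cases q) auto
  moreover have "n * (q - 1) = (n - d) * (q - 1) + (q - 1) * d"
  proof -
    have "d \<le> n" using deg by (simp only: d_def)
    then have "n * (q - 1) = ((n - d) + d) * (q - 1)" by simp
    then show ?thesis by (simp only: add_mult_distrib mult.commute[of d])
  qed
  ultimately have "(n - d) * (q - 1) \<le> (\<Sum>i=1..n. y i - 1)" by linarith
  then have "q ^ (n - d) \<le> (\<Prod>i=1..n. y i)" using y(1) q by (intro power_le_prod_distribution) auto
  then show ?thesis using y(3) unfolding F0[symmetric] q_def d_def by linarith
qed

lemma brink_min_distribution:
  assumes "brink_setting K P q n A r v p" "card (restricted_zeros K P n A r v p) \<noteq> 0"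
  shows "min_distribution n (\<lambda>i. card (A i))
              ((\<Sum>i=1..n. int (card (A i))) - weighted_degree q r v p)
         \<le> card (restricted_zeros K P n A r v p)"
proof -
  obtain y where y: "\<forall>i\<in>{1..n}. 1 \<le> y i \<and> y i \<le> card (A i)"
      "(\<Sum>i=1..n. int (card (A i))) \<le> (\<Sum>i=1..n. int (y i)) + weighted_degree q r v p"
      "(\<Prod>i=1..n. y i) \<le> card (restricted_zeros K P n A r v p)"
    using brink_setting_distribution[OF assms] by blast
  have "min_distribution n (\<lambda>i. card (A i))
      ((\<Sum>i=1..n. int (card (A i))) - weighted_degree q r v p) \<le> (\<Prod>i=1..n. y i)"
    using y by (intro min_distribution_le) auto
  then show ?thesis using y(3) by linarith
qed

lemma brink_not_unique:
  assumes "brink_setting K P q n A r v p"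
    and "weighted_degree q r v p < (\<Sum>i=1..n. int (card (A i)) - 1)"
  shows "card (restricted_zeros K P n A r v p) \<noteq> 1"
proof
  assume one: "card (restricted_zeros K P n A r v p) = 1"
  then have "card (restricted_zeros K P n A r v p) \<noteq> 0" by simp
  from brink_setting_distribution[OF assms(1) this, unfolded one]
  obtain y where y: "\<forall>i\<in>{1..n}. 1 \<le> y i \<and> y i \<le> card (A i)"
      "(\<Sum>i=1..n. int (card (A i))) \<le> (\<Sum>i=1..n. int (y i)) + weighted_degree q r v p"
      "(\<Prod>i=1..n. y i) \<le> 1"
    by blast
  have "y i \<le> 1" if "i \<in> {1..n}" for i
  proof -
    have "y i dvd (\<Prod>i=1..n. y i)" using that by (intro dvd_prodI) auto
    moreover have "(\<Prod>i=1..n. y i) > 0" using y(1) by (intro prod_pos) (simp add: Suc_le_eq)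
    ultimately show ?thesis using y(3) dvd_imp_le le_trans by blast
  qed
  then have "(\<Sum>i=1..n. int (y i)) \<le> (\<Sum>i=1..n. 1)" by (intro sum_mono) auto
  then show False using y(2) assms(2) by (simp add: sum_subtractf)
qed

lemma brink_boolean:
  assumes "brink_setting K P q n A r v p" "\<And>i. i \<in> {1..n} \<Longrightarrow> A i = {0, 1}"
    and "card (restricted_zeros K P n A r v p) \<noteq> 0"
  shows "2 powi (int n - weighted_degree q r v p) \<le> real (card (restricted_zeros K P n A r v p))"
proof -
  have card2: "card (A i) = 2" if "i \<in> {1..n}" for i using assms(2)[OF that] by simp
  obtain y where y: "\<forall>i\<in>{1..n}. 1 \<le> y i \<and> y i \<le> card (A i)"
      "(\<Sum>i=1..n. int (card (A i))) \<le> (\<Sum>i=1..n. int (y i)) + weighted_degree q r v p"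
      "(\<Prod>i=1..n. y i) \<le> card (restricted_zeros K P n A r v p)"
    using brink_setting_distribution[OF assms(1,3)] by blast
  define k where "k = (\<Sum>i=1..n. y i - 1)"
  have "(\<Sum>i=1..n. int (y i)) = (\<Sum>i=1..n. int (y i - 1) + 1)"
    using y(1) by (intro sum.cong) (auto simp: of_nat_diff)
  also have "\<dots> = int k + int n" by (simp add: k_def sum.distrib)
  finally have "int n - weighted_degree q r v p \<le> int k" using y(2) card2 by simp
  then have "(2::real) powi (int n - weighted_degree q r v p) \<le> 2 powi (int k)"
    by (intro power_int_increasing) auto
  also have "\<dots> = real (2 ^ k)" by simp
  also have "2 ^ k \<le> (\<Prod>i=1..n. y i)"
    using y(1) card2 by (intro power_le_prod_distribution) (auto simp: k_def)
  finally have "2 powi (int n - weighted_degree q r v p) \<le> real (\<Prod>i=1..n. y i)" by simp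
  then show ?thesis using y(3) by (meson of_nat_le_iff order_trans)
qed

theorem theorem1p6:
  shows
    \<comment> \<open>a)\<close>
    "(\<forall>(K :: 'a::field_char_0 set) \<pp> q n A r v P.
        brink_setting K \<pp> q n A r v P \<longrightarrow>
          card (restricted_zeros K \<pp> n A r v P) = 0 \<or>
          card (restricted_zeros K \<pp> n A r v P) \<ge>
            min_distribution n (\<lambda>i. card (A i))
              ((\<Sum>i=1..n. int (card (A i))) - weighted_degree q r v P))
     \<and>
     \<comment> \<open>b) (i) Warning's Second Theorem\<close>
     (\<forall>n r (d :: nat \<Rightarrow> nat) (P :: nat \<Rightarrow> 'f::{field, finite} mpolynomial).
        n \<ge> 1 \<and> r \<ge> 1 \<and> (\<forall>i\<in>{1..r}. d i \<ge> 1) \<and> (\<Sum>i=1..r. d i) < n \<and>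
        (\<forall>i\<in>{1..r}. P i \<in> mpoly_carrier UNIV n \<and> total_degree (P i) = d i) \<longrightarrow>
          (let z = card {x \<in> PiE {1..n} (\<lambda>_. UNIV). \<forall>i\<in>{1..r}. eval_mpoly (P i) x = 0}
           in z = 0 \<or> z \<ge> card (UNIV :: 'f set) ^ (n - (\<Sum>i=1..r. d i))))
     \<and>
     \<comment> \<open>b) (ii) Brink's Theorem in a number field\<close>
     (\<forall>(K :: 'a set) \<pp> q n A r v P.
        brink_setting K \<pp> q n A r v P \<and>
        weighted_degree q r v P < (\<Sum>i=1..n. int (card (A i)) - 1) \<longrightarrow>
          card (restricted_zeros K \<pp> n A r v P) \<noteq> 1)
     \<and>
     (\<forall>(K :: 'a set) \<pp> q n A r v P.
        brink_setting K \<pp> q n A r v P \<and> (\<forall>i\<in>{1..n}. A i = {0, 1}) \<and>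
        weighted_degree q r v P < int n \<longrightarrow>
          card (restricted_zeros K \<pp> n A r v P) \<noteq> 1)
     \<and>
     \<comment> \<open>c)\<close>
     (\<forall>(K :: 'a set) \<pp> q n A r v P.
        brink_setting K \<pp> q n A r v P \<and> (\<forall>i\<in>{1..n}. A i = {0, 1}) \<longrightarrow>
          card (restricted_zeros K \<pp> n A r v P) = 0 \<or>
          real (card (restricted_zeros K \<pp> n A r v P)) \<ge>
            2 powi (int n - weighted_degree q r v P))"
proof (intro conjI allI impI)
  fix K :: "'a set" and P q n A r v and p :: "nat \<Rightarrow> 'a mpolynomial"
  assume "brink_setting K P q n A r v p"
  then show "card (restricted_zeros K P n A r v p) = 0 \<or>
          card (restricted_zeros K P n A r v p) \<ge>
            min_distribution n (\<lambda>i. card (A i))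
              ((\<Sum>i=1..n. int (card (A i))) - weighted_degree q r v p)"
    using brink_min_distribution by blast
next
  fix n r and d :: "nat \<Rightarrow> nat" and P :: "nat \<Rightarrow> 'f mpolynomial"
  assume asm: "n \<ge> 1 \<and> r \<ge> 1 \<and> (\<forall>i\<in>{1..r}. d i \<ge> 1) \<and> (\<Sum>i=1..r. d i) < n \<and>
        (\<forall>i\<in>{1..r}. P i \<in> mpoly_carrier UNIV n \<and> total_degree (P i) = d i)"
  have d: "(\<Sum>i=1..r. total_degree (P i)) = (\<Sum>i=1..r. d i)" using asm by (intro sum.cong) auto
  let ?Z = "{x \<in> PiE {1..n} (\<lambda>_. UNIV). \<forall>i\<in>{1..r}. eval_mpoly (P i) x = 0}"
  have "card ?Z = 0 \<or> card ?Z \<ge> card (UNIV :: 'f set) ^ (n - (\<Sum>i=1..r. d i))"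
  proof (cases "?Z = {}")
    case True
    then show ?thesis by (metis card.empty)
  next
    case False
    then show ?thesis using warning_second[of r P n] asm unfolding d by auto
  qed
  then show "let z = card ?Z in z = 0 \<or> z \<ge> card (UNIV :: 'f set) ^ (n - (\<Sum>i=1..r. d i))"
    by (simp only: Let_def)
next
  fix K :: "'a set" and P q n A r v and p :: "nat \<Rightarrow> 'a mpolynomial"
  assume "brink_setting K P q n A r v p \<and>
        weighted_degree q r v p < (\<Sum>i=1..n. int (card (A i)) - 1)"
  then show "card (restricted_zeros K P n A r v p) \<noteq> 1" using brink_not_unique by blast
next
  fix K :: "'a set" and P q n A r v and p :: "nat \<Rightarrow> 'a mpolynomial"
  assume asm: "brink_setting K P q n A r v p \<and> (\<forall>i\<in>{1..n}. A i = {0, 1}) \<and>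
        weighted_degree q r v p < int n"
  then have "(\<Sum>i=1..n. int (card (A i)) - 1) = int n" by simp
  then show "card (restricted_zeros K P n A r v p) \<noteq> 1" using asm by (intro brink_not_unique) auto
next
  fix K :: "'a set" and P q n A r v and p :: "nat \<Rightarrow> 'a mpolynomial"
  assume "brink_setting K P q n A r v p \<and> (\<forall>i\<in>{1..n}. A i = {0, 1})"
  then show "card (restricted_zeros K P n A r v p) = 0 \<or>
          real (card (restricted_zeros K P n A r v p)) \<ge>
            2 powi (int n - weighted_degree q r v p)"
    using brink_boolean by blast
qed

end
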